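(* Let $\Sigma$ be a signed graph and $\mathbb A$ an abelian group. Then $${\rm H}_0(\Sigma,\mathbb A)\cong(\mathbb A/2\mathbb A)^{u_c(\Sigma)}\oplus\mathbb A^{b(\Sigma)}.$$ If $\mathbb A$ is finite, then ${\rm H}_0(\Sigma,\mathbb A)\cong({\rm Tor}_2\mathbb A)^{u_c(\Sigma)}\oplus\mathbb A^{b(\Sigma)}$.
   Context: A graph $(V,E)$ has finite vertex set $V$ and finite edge set $E$ (multiple edges allowed); each edge has two ends, each end is attached to one vertex or to none, and at least one end is attached to a vertex. A loop has both ends at the same vertex, a link has its ends at two distinct vertices, an outer-edge has exactly one end attached to a vertex. A signed graph $\Sigma=(V,E,\sigma)$ is a graph with a sign function $\sigma:E\to\{1,-1\}$. A circle is a connected 2-regular signed (sub)graph without outer-edges (a loop with its vertex is a circle); its sign is the product of its edge signs. A signed graph is balanced if it has no outer-edges and all its circles are positive; otherwise unbalanced. $b(\Sigma)$ is the number of balanced components and $u_c(\Sigma)$ the number of unbalanced components without outer-edges. $2\mathbb A=\{2a:a\in\mathbb A\}$, ${\rm Tor}_2(\mathbb A)=\{a\in\mathbb A:2a=0\}$. Each edge $e$ has exactly two orientations (arcs) $\vec e$ and $\vec e^{\,-1}$: an orientation puts an arrow on each of the two ends of $e$, with the same direction along $e$ if $e$ is positive and opposite directions if $e$ is negative; $\vec e^{\,-1}$ reverses both arrows. $\vec E$ is the set of all arcs. $[v,\vec e\,]$ is $1$ (resp. $-1$) if $\vec e$ is a non-loop arc at $v$ whose arrow at $v$ points to (resp.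 away from) $v$; $2$ (resp. $-2$) if $\vec e$ is a negative loop at $v$ pointing to (resp. away from) $v$; $0$ otherwise. ${\rm C}_1(\Sigma,\mathbb A)$ is the group of functions ${\bf c}:\vec E\to\mathbb A$ with ${\bf c}(\vec e^{\,-1})=-{\bf c}(\vec e\,)$; ${\rm C}_0(\Sigma,\mathbb A)$ is the group of functions $V\to\mathbb A$. The boundary operator $\partial:{\rm C}_1(\Sigma,\mathbb A)\to{\rm C}_0(\Sigma,\mathbb A)$ is $(\partial{\bf c})(v)=\sum_{e\in E}[v,\vec e\,]{\bf c}(\vec e\,)$, and ${\rm H}_0(\Sigma,\mathbb A)={\rm C}_0(\Sigma,\mathbb A)/{\rm im}\,\partial$. *)

theory Defs
  imports "HOL-Algebra.Algebra"
begin

section \<open>Signed graphs\<close>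

text \<open>
  The two ends of an edge are named \<^term>\<open>True\<close> and \<^term>\<open>False\<close>;
  \<open>att G e i\<close> is the vertex to which the end \<open>i\<close> of \<open>e\<close> is attached, and
  \<^term>\<open>None\<close> if that end is attached to no vertex.
\<close>

record ('v, 'e) sgraph =
  vertices :: "'v set"
  edges :: "'e set"
  att :: "'e \<Rightarrow> bool \<Rightarrow> 'v option"
  esign :: "'e \<Rightarrow> int"

locale signed_graph =
  fixes G :: "('v, 'e) sgraph"
  assumes finite_vertices: "finite (vertices G)"
    and finite_edges: "finite (edges G)"
    and att_closed: "\<lbrakk>e \<in> edges G; att G e i = Some v\<rbrakk> \<Longrightarrow> v \<in> vertices G"
    and att_ex: "e \<in> edges G \<Longrightarrow> \<exists>i. att G e i \<noteq> None"
    and esign_range: "e \<in> edges G \<Longrightarrow> esign G e \<in> {1, -1}"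

definition loop_at :: "('v, 'e) sgraph \<Rightarrow> 'e \<Rightarrow> 'v \<Rightarrow> bool" where
  "loop_at G e v \<longleftrightarrow> (\<forall>i. att G e i = Some v)"

definition outer_edge :: "('v, 'e) sgraph \<Rightarrow> 'e \<Rightarrow> bool" where
  "outer_edge G e \<longleftrightarrow> (\<exists>!i. att G e i \<noteq> None)"

definition no_outer_edges :: "('v, 'e) sgraph \<Rightarrow> bool" where
  "no_outer_edges G \<longleftrightarrow> (\<forall>e\<in>edges G. \<not> outer_edge G e)"

definition subgraph :: "('v, 'e) sgraph \<Rightarrow> ('v, 'e) sgraph \<Rightarrow> bool" where
  "subgraph H G \<longleftrightarrow> signed_graph H \<and> vertices H \<subseteq> vertices G \<and> edges H \<subseteq> edges G \<and>
     att H = att G \<and> esign H = esign G"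

definition adjacency :: "('v, 'e) sgraph \<Rightarrow> ('v \<times> 'v) set" where
  "adjacency G = {(u, v). \<exists>e\<in>edges G. \<exists>i. att G e i = Some u \<and> att G e (\<not> i) = Some v}"

definition connected_graph :: "('v, 'e) sgraph \<Rightarrow> bool" where
  "connected_graph G \<longleftrightarrow> vertices G \<noteq> {} \<and>
     (\<forall>u\<in>vertices G. \<forall>v\<in>vertices G. (u, v) \<in> (adjacency G)\<^sup>*)"

definition components :: "('v, 'e) sgraph \<Rightarrow> ('v, 'e) sgraph set" where
  "components G = {C. subgraph C G \<and> connected_graph C \<and>
     (\<forall>D. subgraph D G \<and> connected_graph D \<and> subgraph C D \<longrightarrow> D = C)}"

text \<open>The degree counts edge ends, so a loop contributes 2.\<close>

definition degree :: "('v, 'e) sgraph \<Rightarrow> 'v \<Rightarrow> nat" where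
  "degree G v = card {(e, i). e \<in> edges G \<and> att G e i = Some v}"

definition circle :: "('v, 'e) sgraph \<Rightarrow> bool" where
  "circle C \<longleftrightarrow> signed_graph C \<and> connected_graph C \<and> no_outer_edges C \<and>
     (\<forall>v\<in>vertices C. degree C v = 2)"

definition circle_sign :: "('v, 'e) sgraph \<Rightarrow> int" where
  "circle_sign C = (\<Prod>e\<in>edges C. esign C e)"

definition balanced :: "('v, 'e) sgraph \<Rightarrow> bool" where
  "balanced G \<longleftrightarrow> no_outer_edges G \<and>
     (\<forall>C. subgraph C G \<and> circle C \<longrightarrow> circle_sign C = 1)"

definition num_balanced :: "('v, 'e) sgraph \<Rightarrow> nat" where
  "num_balanced G = card {C \<in> components G. balanced C}"

definition num_unbalanced_closed :: "('v, 'e) sgraph \<Rightarrow> nat" where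
  "num_unbalanced_closed G = card {C \<in> components G. \<not> balanced C \<and> no_outer_edges C}"


section \<open>Arcs\<close>

text \<open>
  An arc \<open>(e, t)\<close> is an edge with an arrow on each of its ends: \<open>t i = 1\<close> if the arrow
  on the end \<open>i\<close> points outwards, that is, towards the vertex (if any) to which this end is
  attached, and \<open>t i = -1\<close> if it points away from it, into the edge.  Two arrows with the same
  direction along \<open>e\<close> therefore have opposite values, so the rule relating
  arrows and sign becomes \<open>t True * t False = - esign G e\<close>.
\<close>

definition arcs :: "('v, 'e) sgraph \<Rightarrow> ('e \<times> (bool \<Rightarrow> int)) set" where
  "arcs G = {(e, t). e \<in> edges G \<and> (\<forall>i. t i \<in> {1, -1}) \<and> t True * t False = - esign G e}"

definition arc_inv :: "'e \<times> (bool \<Rightarrow> int) \<Rightarrow> 'e \<times> (bool \<Rightarrow> int)" where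
  "arc_inv a = (fst a, \<lambda>i. - snd a i)"

text \<open>On a negative loop both arrows point to the vertex, or both point away from it.\<close>

definition bracket :: "('v, 'e) sgraph \<Rightarrow> 'v \<Rightarrow> 'e \<times> (bool \<Rightarrow> int) \<Rightarrow> int" where
  "bracket G v a =
     (let e = fst a; t = snd a in
      if loop_at G e v then (if esign G e = -1 then 2 * t True else 0)
      else if att G e True = Some v then t True
      else if att G e False = Some v then t False
      else 0)"

definition orient :: "('v, 'e) sgraph \<Rightarrow> 'e \<Rightarrow> 'e \<times> (bool \<Rightarrow> int)" where
  "orient G e = (SOME a. a \<in> arcs G \<and> fst a = e)"


section \<open>Chains and homology\<close>

text \<open>
  The coefficient group is a commutative group of HOL-Algebra, hence written multiplicatively:
  \<open>k a\<close> becomes \<open>a [^] k\<close>, and \<open>-a\<close> becomes \<open>inv a\<close>.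
\<close>

definition chain0 :: "('v, 'e) sgraph \<Rightarrow> ('a, 'm) monoid_scheme \<Rightarrow> ('v \<Rightarrow> 'a) monoid" where
  "chain0 G A = product_group (vertices G) (\<lambda>_. A)"

definition chain1 ::
  "('v, 'e) sgraph \<Rightarrow> ('a, 'm) monoid_scheme \<Rightarrow> ('e \<times> (bool \<Rightarrow> int) \<Rightarrow> 'a) monoid" where
  "chain1 G A = (product_group (arcs G) (\<lambda>_. A))
     \<lparr>carrier := {c \<in> carrier (product_group (arcs G) (\<lambda>_. A)).
                   \<forall>a\<in>arcs G. c (arc_inv a) = inv\<^bsub>A\<^esub> c a}\<rparr>"

text \<open>
  The choice of an arc for every edge is immaterial, see \<open>boundary_any_orientation\<close> below.
\<close>

definition boundary ::
  "('v, 'e) sgraph \<Rightarrow> ('a, 'm) monoid_scheme \<Rightarrow> ('e \<times> (bool \<Rightarrow> int) \<Rightarrow> 'a) \<Rightarrow> ('v \<Rightarrow> 'a)" where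
  "boundary G A c =
     (\<lambda>v\<in>vertices G. \<Otimes>\<^bsub>A\<^esub>e\<in>edges G. c (orient G e) [^]\<^bsub>A\<^esub> bracket G v (orient G e))"

definition homology0 ::
  "('v, 'e) sgraph \<Rightarrow> ('a, 'm) monoid_scheme \<Rightarrow> ('v \<Rightarrow> 'a) set monoid" where
  "homology0 G A = chain0 G A Mod (boundary G A ` carrier (chain1 G A))"

definition doubles :: "('a, 'm) monoid_scheme \<Rightarrow> 'a set" where
  "doubles A = {a [^]\<^bsub>A\<^esub> (2::nat) | a. a \<in> carrier A}"

definition tor2 :: "('a, 'm) monoid_scheme \<Rightarrow> ('a, 'm) monoid_scheme" where
  "tor2 A = A\<lparr>carrier := {a \<in> carrier A. a [^]\<^bsub>A\<^esub> (2::nat) = \<one>\<^bsub>A\<^esub>}\<rparr>"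

abbreviation direct_power :: "('a, 'm) monoid_scheme \<Rightarrow> nat \<Rightarrow> (nat \<Rightarrow> 'a) monoid" where
  "direct_power A n \<equiv> product_group {..<n} (\<lambda>_. A)"


section \<open>Well-definedness\<close>

lemma bracket_arc_inv: "bracket G v (arc_inv a) = - bracket G v a"
  by (simp add: bracket_def arc_inv_def Let_def)

context signed_graph
begin

lemma arc_ex:
  assumes "e \<in> edges G" shows "\<exists>a\<in>arcs G. fst a = e"
proof (rule bexI)
  show "(e, \<lambda>i. if i then 1 else - esign G e) \<in> arcs G"
    using assms esign_range[OF assms] by (auto simp: arcs_def)
qed simp

lemma orient_arc:
  assumes "e \<in> edges G" shows "orient G e \<in> arcs G" and "fst (orient G e) = e"
proof -
  have "orient G e \<in> arcs G \<and> fst (orient G e) = e"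
    unfolding orient_def by (rule someI_ex) (use arc_ex[OF assms] in blast)
  then show "orient G e \<in> arcs G" "fst (orient G e) = e"
    by auto
qed

lemma arc_inv_closed: "a \<in> arcs G \<Longrightarrow> arc_inv a \<in> arcs G"
  by (force simp: arcs_def arc_inv_def)

lemma arc_inv_neq:
  assumes "a \<in> arcs G" shows "arc_inv a \<noteq> a"
proof
  assume "arc_inv a = a"
  then have "- snd a True = snd a True"
    by (metis arc_inv_def snd_conv)
  then have "snd a True = 0" by simp
  moreover have "snd a True \<in> {1, -1}"
    using assms by (auto simp: arcs_def)
  ultimately show False by simp
qed

lemma arc_cases:
  assumes "a \<in> arcs G" "b \<in> arcs G" "fst a = fst b"
  shows "b = a \<or> b = arc_inv a"
proof -
  obtain e s t where ab: "a = (e, s)" "b = (e, t)"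
    using assms(3) by (metis prod.collapse)
  have s: "s True \<in> {1, -1}" "s False \<in> {1, -1}" "s True * s False = - esign G e"
    and t: "t True \<in> {1, -1}" "t False \<in> {1, -1}" "t True * t False = - esign G e"
    using assms(1,2) by (auto simp: ab arcs_def)
  have "(t True = s True \<and> t False = s False) \<or> (t True = - s True \<and> t False = - s False)"
    using s t by auto
  then have "(\<forall>i. t i = s i) \<or> (\<forall>i. t i = - s i)"
    by (metis (full_types))
  then show ?thesis
    by (auto simp: ab arc_inv_def fun_eq_iff)
qed

lemma arcs_of_edge:
  assumes "e \<in> edges G"
  shows "{a \<in> arcs G. fst a = e} = {orient G e, arc_inv (orient G e)}"
proof (intro equalityI subsetI)
  fix a assume "a \<in> {a \<in> arcs G. fst a = e}"
  then show "a \<in> {orient G e, arc_inv (orient G e)}"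
    using arc_cases[of "orient G e" a] orient_arc[OF assms] by simp
next
  fix a assume "a \<in> {orient G e, arc_inv (orient G e)}"
  moreover have "fst (arc_inv (orient G e)) = e"
    using orient_arc[OF assms] by (simp add: arc_inv_def)
  ultimately show "a \<in> {a \<in> arcs G. fst a = e}"
    using orient_arc[OF assms] arc_inv_closed by blast
qed

lemma chain0_comm_group:
  assumes "comm_group A" shows "comm_group (chain0 G A)"
proof (rule group.group_comm_groupI)
  interpret A: comm_group A by fact
  show "group (chain0 G A)" by (simp add: chain0_def)
  show "x \<otimes>\<^bsub>chain0 G A\<^esub> y = y \<otimes>\<^bsub>chain0 G A\<^esub> x"
    if "x \<in> carrier (chain0 G A)" "y \<in> carrier (chain0 G A)" for x y
    using that by (auto simp: chain0_def intro!: restrict_ext A.m_comm)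
qed

lemma chain1_subgroup:
  assumes "comm_group A"
  shows "subgroup (carrier (chain1 G A)) (product_group (arcs G) (\<lambda>_. A))"
proof -
  interpret A: comm_group A by fact
  show ?thesis
  proof (rule group.subgroupI)
    show "carrier (chain1 G A) \<noteq> {}"
      using arc_inv_closed
      by (auto simp: chain1_def intro!: exI[of _ "\<lambda>a\<in>arcs G. \<one>\<^bsub>A\<^esub>"])
    show "x \<otimes>\<^bsub>product_group (arcs G) (\<lambda>_. A)\<^esub> y \<in> carrier (chain1 G A)"
      if "x \<in> carrier (chain1 G A)" "y \<in> carrier (chain1 G A)" for x y
      using that arc_inv_closed
      by (auto simp: chain1_def PiE_iff A.inv_mult)
    show "inv\<^bsub>product_group (arcs G) (\<lambda>_. A)\<^esub> x \<in> carrier (chain1 G A)"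
      if "x \<in> carrier (chain1 G A)" for x
    proof -
      have "x \<in> (\<Pi>\<^sub>E i\<in>arcs G. carrier A)"
        using that by (simp add: chain1_def)
      then have "inv\<^bsub>product_group (arcs G) (\<lambda>_. A)\<^esub> x = (\<lambda>a\<in>arcs G. inv\<^bsub>A\<^esub> x a)"
        by simp
      then show ?thesis
        using that arc_inv_closed by (auto simp: chain1_def PiE_iff)
    qed
  qed (auto simp: chain1_def)
qed

lemma chain1_comm_group:
  assumes "comm_group A" shows "comm_group (chain1 G A)"
proof (rule group.group_comm_groupI)
  interpret A: comm_group A by fact
  have "group (product_group (arcs G) (\<lambda>_. A))" by simp
  then have "group ((product_group (arcs G) (\<lambda>_. A))\<lparr>carrier := carrier (chain1 G A)\<rparr>)"
    using chain1_subgroup[OF assms] by (simp add: subgroup.subgroup_is_group)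
  then show "group (chain1 G A)"
    by (simp add: chain1_def)
  show "x \<otimes>\<^bsub>chain1 G A\<^esub> y = y \<otimes>\<^bsub>chain1 G A\<^esub> x"
    if "x \<in> carrier (chain1 G A)" "y \<in> carrier (chain1 G A)" for x y
    using that by (auto simp: chain1_def PiE_iff intro!: restrict_ext A.m_comm)
qed

lemma boundary_any_orientation:
  assumes A: "comm_group A" and c: "c \<in> carrier (chain1 G A)"
    and or: "\<And>e. e \<in> edges G \<Longrightarrow> f e \<in> arcs G \<and> fst (f e) = e"
  shows "boundary G A c =
    (\<lambda>v\<in>vertices G. \<Otimes>\<^bsub>A\<^esub>e\<in>edges G. c (f e) [^]\<^bsub>A\<^esub> bracket G v (f e))"
proof -
  interpret A: comm_group A by fact
  have cl: "c a \<in> carrier A" if "a \<in> arcs G" for a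
    using c that by (auto simp: chain1_def PiE_iff)
  have "c (orient G e) [^]\<^bsub>A\<^esub> bracket G v (orient G e) = c (f e) [^]\<^bsub>A\<^esub> bracket G v (f e)"
    if e: "e \<in> edges G" for e v
  proof -
    have "f e = orient G e \<or> f e = arc_inv (orient G e)"
      using arc_cases[of "orient G e" "f e"] or[OF e] orient_arc[OF e] by auto
    moreover have "c (arc_inv (orient G e)) = inv\<^bsub>A\<^esub> c (orient G e)"
      using c orient_arc(1)[OF e] by (auto simp: chain1_def)
    ultimately show ?thesis
      using cl[OF orient_arc(1)[OF e]]
      by (auto simp: bracket_arc_inv A.int_pow_neg A.int_pow_inv)
  qed
  then show ?thesis
    unfolding boundary_def
    by (intro restrict_ext A.finprod_cong') (auto intro!: A.int_pow_closed cl simp: or)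
qed

lemma boundary_hom:
  assumes "comm_group A" shows "boundary G A \<in> hom (chain1 G A) (chain0 G A)"
proof (rule homI)
  interpret A: comm_group A by fact
  have cl: "c (orient G e) \<in> carrier A" if "c \<in> carrier (chain1 G A)" "e \<in> edges G" for c e
    using that orient_arc(1) by (auto simp: chain1_def PiE_iff)
  show "boundary G A c \<in> carrier (chain0 G A)" if "c \<in> carrier (chain1 G A)" for c
    using that by (auto simp: boundary_def chain0_def intro!: A.finprod_closed A.int_pow_closed cl)
  show "boundary G A (c \<otimes>\<^bsub>chain1 G A\<^esub> d) = boundary G A c \<otimes>\<^bsub>chain0 G A\<^esub> boundary G A d"
    if c: "c \<in> carrier (chain1 G A)" and d: "d \<in> carrier (chain1 G A)" for c d
  proof -
    have "(\<Otimes>\<^bsub>A\<^esub>e\<in>edges G. (c \<otimes>\<^bsub>chain1 G A\<^esub> d) (orient G e) [^]\<^bsub>A\<^esub> bracket G v (orient G e))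
      = (\<Otimes>\<^bsub>A\<^esub>e\<in>edges G. c (orient G e) [^]\<^bsub>A\<^esub> bracket G v (orient G e)
          \<otimes>\<^bsub>A\<^esub> d (orient G e) [^]\<^bsub>A\<^esub> bracket G v (orient G e))" for v
      using orient_arc(1)
      by (intro A.finprod_cong')
        (auto simp: chain1_def A.int_pow_distrib cl[OF c] cl[OF d] A.int_pow_closed)
    then show ?thesis
      by (auto simp: boundary_def chain0_def A.finprod_multf A.int_pow_closed cl[OF c] cl[OF d] Pi_iff
          intro!: restrict_ext)
  qed
qed

lemma homology0_comm_group:
  assumes "comm_group A" shows "comm_group (homology0 G A)"
proof -
  interpret group_hom "chain1 G A" "chain0 G A" "boundary G A"
    using chain0_comm_group[OF assms] chain1_comm_group[OF assms] boundary_hom[OF assms]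
    by (simp add: group_hom_def group_hom_axioms_def comm_group.axioms)
  show ?thesis
    unfolding homology0_def
    by (rule comm_group.abelian_FactGroup[OF chain0_comm_group[OF assms] img_is_subgroup])
qed

end

end

theory Submission
  imports Defs
begin

text \<open>
  Modulo boundaries, the value \<open>a\<close> placed at a vertex \<open>u\<close> equals \<open>a\<close> or its inverse placed at a neighbour
  \<open>v\<close>, according to the sign of the edge between them (\<open>vclass_edge\<close>), and an outer-edge at \<open>u\<close> kills all
  values placed at \<open>u\<close> (\<open>vclass_outer\<close>).  Every 0-chain can therefore be moved to one root per component,
  the value at \<open>v\<close> being raised to the sign of a walk from \<open>v\<close> to the root.  The product of the moved
  values over a component \<open>C\<close> is \<open>csum C\<close>.  What remains is to decide which values at a root are boundaries,
  and there are three cases.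

  If \<open>C\<close> has an outer-edge, all values are boundaries.  If \<open>C\<close> has no outer-edge and is unbalanced, there
  is a negative closed walk at the root; it identifies \<open>a\<close> with its inverse, so all doubles are boundaries.
  Nothing else is, because the boundary at an edge changes \<open>csum C\<close> by an even power.  If \<open>C\<close> is balanced, the
  signs of walks to the root form a potential (\<open>balanced_walk_signs_potential\<close>), and the two ends of every
  edge cancel in \<open>csum C\<close>, so only the neutral element is a boundary.  These cases are combined in
  \<open>boundary_iff_csum\<close>, and the first isomorphism theorem gives the first claim.

  The definition of balance speaks of circles, whereas the argument uses closed walks.  The bridge
  is that a shortest negative closed walk traces a negative circle (\<open>negative_closed_walk_circle\<close>), and
  conversely that a potential makes every circle positive (\<open>potential_circle_positive\<close>).

  For finite \<open>A\<close>, squaring \<open>a\<close> to \<open>a \<cdot> a\<close> has kernel \<open>tor2 A\<close> and image \<open>doubles A\<close>, so \<open>A Mod doubles A\<close> and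
  \<open>tor2 A\<close> have the same order.  Both have exponent two, and such finite groups are determined up to
  isomorphism by their order (\<open>exponent_two_iso\<close>).
\<close>

section \<open>Components\<close>

lemma adjacencyI:
  "e \<in> edges G \<Longrightarrow> att G e i = Some u \<Longrightarrow> att G e (\<not> i) = Some v \<Longrightarrow> (u, v) \<in> adjacency G"
  by (auto simp: adjacency_def)

lemma sym_adjacency: "sym (adjacency G)"
proof (rule symI)
  fix u v assume "(u, v) \<in> adjacency G"
  then obtain e i where "e \<in> edges G" "att G e i = Some u" "att G e (\<not> i) = Some v"
    by (auto simp: adjacency_def)
  then show "(v, u) \<in> adjacency G"
    unfolding adjacency_def by (auto intro!: bexI[of _ e] exI[of _ "\<not> i"])
qed

lemma adjacency_rtrancl_sym: "(u, v) \<in> (adjacency G)\<^sup>* \<Longrightarrow> (v, u) \<in> (adjacency G)\<^sup>*"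
  using sym_rtrancl[OF sym_adjacency] by (rule symD)

lemma adjacency_mono: "subgraph H G \<Longrightarrow> adjacency H \<subseteq> adjacency G"
  by (auto simp: adjacency_def subgraph_def)

lemma subgraph_antisym: "subgraph C D \<Longrightarrow> subgraph D C \<Longrightarrow> C = D"
  by (auto simp: subgraph_def intro: sgraph.equality)

text \<open>
  The edges include the outer-edges at reachable vertices; this is what makes the subgraph
  maximal and not merely connected.
\<close>

definition component_of :: "('v, 'e) sgraph \<Rightarrow> 'v \<Rightarrow> ('v, 'e) sgraph" where
  "component_of G v =
     \<lparr>vertices = {u. (v, u) \<in> (adjacency G)\<^sup>*},
      edges = {e \<in> edges G. \<exists>i u. att G e i = Some u \<and> (v, u) \<in> (adjacency G)\<^sup>*},
      att = att G, esign = esign G\<rparr>"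

context signed_graph
begin

lemma reachable_vertex: "(u, v) \<in> (adjacency G)\<^sup>* \<Longrightarrow> u \<in> vertices G \<Longrightarrow> v \<in> vertices G"
  by (induction rule: rtrancl_induct) (auto simp: adjacency_def dest: att_closed)

lemma subgraph_component_of:
  assumes "v \<in> vertices G" shows "subgraph (component_of G v) G"
proof -
  have closed: "(v, w) \<in> (adjacency G)\<^sup>*"
    if "e \<in> edges G" "att G e i = Some u" "(v, u) \<in> (adjacency G)\<^sup>*" "att G e j = Some w" for e i j u w
  proof (cases "j = i")
    case False
    then have "j = (\<not> i)" by auto
    then have "(u, w) \<in> adjacency G"
      using that adjacencyI[of e G i u w] by simp
    then show ?thesis using that by (meson rtrancl.rtrancl_into_rtrancl)
  qed (use that in simp)
  have "signed_graph (component_of G v)"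
  proof
    show "finite (vertices (component_of G v))"
      using reachable_vertex[OF _ assms] finite_vertices
      by (auto simp: component_of_def intro: finite_subset[of _ "vertices G"])
    show "finite (edges (component_of G v))"
      using finite_edges by (auto simp: component_of_def)
    show "u \<in> vertices (component_of G v)"
      if "e \<in> edges (component_of G v)" "att (component_of G v) e i = Some u" for e i u
    proof -
      obtain j w where "e \<in> edges G" "att G e j = Some w" "(v, w) \<in> (adjacency G)\<^sup>*" "att G e i = Some u"
        using \<open>e \<in> edges (component_of G v)\<close> \<open>att (component_of G v) e i = Some u\<close>
        by (auto simp: component_of_def)
      then show ?thesis using closed[of e j w i u] by (simp add: component_of_def)
    qed
    show "\<exists>i. att (component_of G v) e i \<noteq> None" "esign (component_of G v) e \<in> {1, -1}"
      if "e \<in> edges (component_of G v)" for e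
      using that att_ex[of e] esign_range[of e] by (simp_all add: component_of_def)
  qed
  then show ?thesis
    using reachable_vertex[OF _ assms] by (auto simp: subgraph_def component_of_def)
qed

lemma connected_component_of:
  assumes "v \<in> vertices G" shows "connected_graph (component_of G v)"
proof -
  have *: "(v, u) \<in> (adjacency (component_of G v))\<^sup>*" if "(v, u) \<in> (adjacency G)\<^sup>*" for u
    using that
  proof (induction rule: rtrancl_induct)
    case (step y z)
    then obtain e i where e: "e \<in> edges G" "att G e i = Some y" "att G e (\<not> i) = Some z"
      unfolding adjacency_def by blast
    then have "e \<in> edges (component_of G v)"
      using step.hyps(1) by (auto simp: component_of_def)
    with e have "(y, z) \<in> adjacency (component_of G v)"
      by (intro adjacencyI) (simp_all add: component_of_def)
    with step.IH show ?case by (meson rtrancl.rtrancl_into_rtrancl)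
  qed simp
  show ?thesis
    unfolding connected_graph_def
  proof (intro conjI ballI)
    show "vertices (component_of G v) \<noteq> {}" by (auto simp: component_of_def)
    fix u w assume "u \<in> vertices (component_of G v)" "w \<in> vertices (component_of G v)"
    then have "(v, u) \<in> (adjacency G)\<^sup>*" "(v, w) \<in> (adjacency G)\<^sup>*"
      by (simp_all add: component_of_def)
    then show "(u, w) \<in> (adjacency (component_of G v))\<^sup>*"
      using * adjacency_rtrancl_sym by (meson rtrancl_trans)
  qed
qed

lemma connected_subgraph_component_of:
  assumes "subgraph D G" "connected_graph D" "v \<in> vertices D"
  shows "subgraph D (component_of G v)"
proof -
  interpret D: signed_graph D using assms by (simp add: subgraph_def)
  have r: "(v, u) \<in> (adjacency G)\<^sup>*" if "u \<in> vertices D" for u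
    using assms that rtrancl_mono[OF adjacency_mono[OF assms(1)]]
    by (auto simp: connected_graph_def)
  have "\<exists>i u. att G e i = Some u \<and> (v, u) \<in> (adjacency G)\<^sup>*" if e: "e \<in> edges D" for e
  proof -
    obtain i u where iu: "att D e i = Some u"
      using D.att_ex[OF e] by blast
    then show ?thesis
      using r[OF D.att_closed[OF e iu]] assms(1) by (auto simp: subgraph_def)
  qed
  with r show ?thesis
    using assms(1) by (auto simp: subgraph_def component_of_def)
qed

text \<open>
  Any connected subgraph through \<open>v\<close> lies inside \<open>component_of G v\<close>, which is itself connected, so
  maximality can only be attained there.  This replaces the maximality condition by reachability.
\<close>

lemma components_eq: "components G = component_of G ` vertices G"
proof (intro equalityI subsetI)
  fix C assume C: "C \<in> components G"
  then obtain v where v: "v \<in> vertices C"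
    by (auto simp: components_def connected_graph_def)
  then have vG: "v \<in> vertices G" using C by (auto simp: components_def subgraph_def)
  have "subgraph C (component_of G v)"
    using C v connected_subgraph_component_of by (simp add: components_def)
  then have "component_of G v = C"
    using C subgraph_component_of[OF vG] connected_component_of[OF vG] by (auto simp: components_def)
  with vG show "C \<in> component_of G ` vertices G" by blast
next
  fix C assume "C \<in> component_of G ` vertices G"
  then obtain v where v: "v \<in> vertices G" and C: "C = component_of G v" by blast
  have "D = C" if "subgraph D G" "connected_graph D" "subgraph C D" for D
  proof -
    have "v \<in> vertices C" by (simp add: C component_of_def)
    then have "v \<in> vertices D" using that by (auto simp: subgraph_def)
    then show ?thesis
      using connected_subgraph_component_of that subgraph_antisym C by blast
  qed
  then show "C \<in> components G"
    using subgraph_component_of[OF v] connected_component_of[OF v] by (auto simp: C components_def)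
qed

lemma finite_components: "finite (components G)"
  by (simp add: components_eq finite_vertices)

lemma component_subgraph: "C \<in> components G \<Longrightarrow> subgraph C G"
  and component_connected: "C \<in> components G \<Longrightarrow> connected_graph C"
  by (auto simp: components_def)

lemma component_eqI:
  assumes "C \<in> components G" "v \<in> vertices C" shows "C = component_of G v"
proof -
  have "v \<in> vertices G" using assms by (auto simp: components_def subgraph_def)
  then show ?thesis
    using assms connected_subgraph_component_of[of C v]
      subgraph_component_of[of v] connected_component_of[of v]
    by (auto simp: components_def)
qed

lemma components_disjoint:
  "C \<in> components G \<Longrightarrow> D \<in> components G \<Longrightarrow> v \<in> vertices C \<Longrightarrow> v \<in> vertices D \<Longrightarrow> C = D"
  using component_eqI by blast

lemma vertices_components: "\<Union> (vertices ` components G) = vertices G"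
proof (intro equalityI subsetI)
  fix v assume "v \<in> vertices G"
  then show "v \<in> \<Union> (vertices ` components G)"
    by (auto simp: components_eq component_of_def intro!: bexI[of _ v])
qed (auto dest!: component_subgraph simp: subgraph_def)

lemma edge_in_component:
  assumes "C \<in> components G" "e \<in> edges G" "att G e i = Some u" "u \<in> vertices C"
  shows "e \<in> edges C"
  using component_eqI[OF assms(1,4)] assms(2,3) by (auto simp: component_of_def)

end

section \<open>Walks\<close>

text \<open>
  A step of a walk is an edge together with the end at which it is entered, so that the direction
  in which a loop or one of several parallel edges is traversed is recorded.
\<close>

fun walk :: "('v, 'e) sgraph \<Rightarrow> 'v \<Rightarrow> ('e \<times> bool) list \<Rightarrow> 'v \<Rightarrow> bool" where
  "walk G u [] v \<longleftrightarrow> u = v"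
| "walk G u (d # ds) v \<longleftrightarrow> fst d \<in> edges G \<and> att G (fst d) (snd d) = Some u \<and>
     (\<exists>x. att G (fst d) (\<not> snd d) = Some x \<and> walk G x ds v)"

definition walk_sign :: "('v, 'e) sgraph \<Rightarrow> ('e \<times> bool) list \<Rightarrow> int" where
  "walk_sign G ds = (\<Prod>d\<leftarrow>ds. esign G (fst d))"

lemma walk_sign_simps [simp]:
  "walk_sign G [] = 1"
  "walk_sign G (d # ds) = esign G (fst d) * walk_sign G ds"
  "walk_sign G (ds @ ds') = walk_sign G ds * walk_sign G ds'"
  by (simp_all add: walk_sign_def)

lemma walk_append: "walk G u (xs @ ys) v \<longleftrightarrow> (\<exists>x. walk G u xs x \<and> walk G x ys v)"
  by (induction xs arbitrary: u) auto

definition reverse_walk :: "('e \<times> bool) list \<Rightarrow> ('e \<times> bool) list" where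
  "reverse_walk ds = rev (map (\<lambda>(e, i). (e, \<not> i)) ds)"

lemma walk_sign_reverse [simp]: "walk_sign G (reverse_walk ds) = walk_sign G ds"
  by (induction ds) (auto simp: reverse_walk_def)

lemma walk_reverse: "walk G u ds v \<Longrightarrow> walk G v (reverse_walk ds) u"
  by (induction ds arbitrary: u) (auto simp: reverse_walk_def walk_append)

lemma walk_mono: "subgraph H G \<Longrightarrow> walk H u ds v \<Longrightarrow> walk G u ds v"
  by (induction ds arbitrary: u) (auto simp: subgraph_def)

lemma walk_sign_mono: "subgraph H G \<Longrightarrow> walk_sign H ds = walk_sign G ds"
  by (simp add: subgraph_def walk_sign_def)

lemma reachable_walk: "(u, v) \<in> (adjacency G)\<^sup>* \<Longrightarrow> \<exists>ds. walk G u ds v"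
proof (induction rule: converse_rtrancl_induct)
  case base
  show ?case by (auto intro: exI[of _ "[]"])
next
  case (step y z)
  then obtain e i ds where "e \<in> edges G" "att G e i = Some y" "att G e (\<not> i) = Some z" "walk G z ds v"
    by (auto simp: adjacency_def)
  then have "walk G y ((e, i) # ds) v" by simp
  then show ?case by blast
qed

lemma walk_nth:
  assumes "walk G u ds v" "k < length ds"
  shows "fst (ds ! k) \<in> edges G"
    and "\<exists>x. att G (fst (ds ! k)) (snd (ds ! k)) = Some x"
    and "att G (fst (ds ! k)) (\<not> snd (ds ! k)) =
      (if Suc k < length ds then att G (fst (ds ! Suc k)) (snd (ds ! Suc k)) else Some v)"
proof -
  have "ds = take k ds @ ds ! k # drop (Suc k) ds"
    using assms(2) by (simp add: Cons_nth_drop_Suc)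
  then obtain x where x: "walk G x (ds ! k # drop (Suc k) ds) v"
    using assms(1) by (metis walk_append)
  then show "fst (ds ! k) \<in> edges G" "\<exists>x. att G (fst (ds ! k)) (snd (ds ! k)) = Some x"
    by simp_all
  from x obtain y where y: "att G (fst (ds ! k)) (\<not> snd (ds ! k)) = Some y"
    "walk G y (drop (Suc k) ds) v"
    by auto
  show "att G (fst (ds ! k)) (\<not> snd (ds ! k)) =
      (if Suc k < length ds then att G (fst (ds ! Suc k)) (snd (ds ! Suc k)) else Some v)"
  proof (cases "Suc k < length ds")
    case True
    then have "drop (Suc k) ds = ds ! Suc k # drop (Suc (Suc k)) ds"
      by (simp add: Cons_nth_drop_Suc)
    with y True show ?thesis by simp
  qed (use y in simp)
qed

context signed_graph
begin

lemma esign_cases: "e \<in> edges G \<Longrightarrow> esign G e = 1 \<or> esign G e = -1"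
  using esign_range by blast

lemma walk_sign_cases: "walk G u ds v \<Longrightarrow> walk_sign G ds = 1 \<or> walk_sign G ds = -1"
  by (induction ds arbitrary: u) (auto dest!: esign_cases)

text \<open>
  Take a negative closed walk of least length.  If a vertex were repeated, the walk would split there
  into two shorter closed walks whose signs multiply to \<open>-1\<close>, and one of them would be negative.
\<close>

lemma negative_closed_walk_simple:
  assumes "walk G r cs r" "walk_sign G cs = -1"
  obtains u ds where "walk G u ds u" "walk_sign G ds = -1"
    "distinct (map (\<lambda>d. att G (fst d) (snd d)) ds)"
proof -
  let ?P = "\<lambda>ds. (\<exists>u. walk G u ds u) \<and> walk_sign G ds = -1"
  obtain ds where ds: "?P ds" and min: "\<And>es. ?P es \<Longrightarrow> length ds \<le> length es"
    using ex_has_least_nat[of ?P cs length] assms by blast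
  from ds obtain u where u: "walk G u ds u" and sg: "walk_sign G ds = -1" by blast
  let ?src = "\<lambda>d. att G (fst d) (snd d)"
  have "distinct (map ?src ds)"
  proof (rule ccontr)
    assume "\<not> distinct (map ?src ds)"
    then obtain as y bs cs where eq: "map ?src ds = as @ [y] @ bs @ [y] @ cs"
      using not_distinct_decomp by blast
    then obtain xs d ys d' zs where split: "ds = xs @ (d # ys) @ (d' # zs)" and same: "?src d = ?src d'"
    proof -
      obtain xs ds1 where 1: "ds = xs @ ds1" "map ?src ds1 = [y] @ bs @ [y] @ cs"
        using map_eq_append_conv[THEN iffD1, OF eq] by metis
      obtain d ds2 where 2: "ds1 = d # ds2" "?src d = y" "map ?src ds2 = bs @ [y] @ cs"
        using 1(2) by (auto simp: map_eq_Cons_conv)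
      obtain ys ds3 where 3: "ds2 = ys @ ds3" "map ?src ds3 = [y] @ cs"
        using map_eq_append_conv[THEN iffD1, OF 2(3)] by metis
      obtain d' zs where 4: "ds3 = d' # zs" "?src d' = y"
        using 3(2) by (auto simp: map_eq_Cons_conv)
      show ?thesis using that[of xs d ys d' zs] 1(1) 2(1,2) 3(1) 4 by simp
    qed

    obtain v v' where w: "walk G u xs v" "walk G v (d # ys) v'" "walk G v' (d' # zs) u"
      using u unfolding split walk_append by blast
    moreover have "v = v'" using w(2,3) same by simp
    ultimately have w: "walk G u xs v" "walk G v (d # ys) v" "walk G v (d' # zs) u" by simp_all
    have w': "walk G u (xs @ d' # zs) u"
      using w(1,3) unfolding walk_append by blast
    have "walk_sign G (d # ys) * walk_sign G (xs @ d' # zs) = -1"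
      using sg by (simp add: split mult.assoc mult.left_commute)
    then consider "walk_sign G (d # ys) = -1" | "walk_sign G (xs @ d' # zs) = -1"
      using walk_sign_cases[OF w(2)] by (metis mult_1)
    then show False
    proof cases
      case 1
      then have "length ds \<le> length (d # ys)" using w(2) min by blast
      then show False by (simp add: split)
    next
      case 2
      then have "length ds \<le> length (xs @ d' # zs)" using w' min by blast
      then show False by (simp add: split)
    qed
  qed
  with u sg show ?thesis by (rule that)
qed

text \<open>
  A negative closed walk without repeated vertices traces a circle.  Distinct vertices force distinct
  edges: the only way to use an edge twice is to go along it and straight back, and that walk has
  sign \<open>(\<plusminus>1)\<^sup>2 = 1\<close>.  Each vertex then meets exactly the edge by which the walk leaves it and the one by
  which it arrives, and the sign of the circle is that of the walk.
\<close>

lemma negative_closed_walk_circle: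
  assumes "walk G r cs r" "walk_sign G cs = -1"
  obtains C where "subgraph C G" "circle C" "circle_sign C = -1"
proof -
  obtain u ds where walk: "walk G u ds u" and sign: "walk_sign G ds = -1"
    and dist: "distinct (map (\<lambda>d. att G (fst d) (snd d)) ds)"
    using negative_closed_walk_simple[OF assms] .
  define n where "n = length ds"
  define e where "e k = fst (ds ! k)" for k
  define i where "i k = snd (ds ! k)" for k
  define v where "v k = the (att G (e k) (i k))" for k
  define nxt where "nxt k = Suc k mod n" for k
  have n0: "0 < n" using sign by (auto simp: n_def)
  have nxt_eq: "nxt k = (if Suc k = n then 0 else Suc k)" if "k < n" for k
    using that by (simp add: nxt_def)
  have nxt_less: "nxt k < n" for k
    using n0 by (simp add: nxt_def)
  have edge: "e k \<in> edges G" if "k < n" for k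
    using walk_nth(1)[OF walk] that by (simp add: n_def e_def)
  have tail: "att G (e k) (i k) = Some (v k)" if "k < n" for k
    using walk_nth(2)[OF walk, of k] that by (auto simp: n_def e_def i_def v_def)
  have "att G (e 0) (i 0) = Some u"
    using walk n0 by (cases ds) (auto simp: n_def e_def i_def)
  then have head: "att G (e k) (\<not> i k) = Some (v (nxt k))" if "k < n" for k
    using walk_nth(3)[OF walk, of k] that tail[OF nxt_less[of k]] nxt_eq[OF that]
    by (auto simp: n_def e_def i_def split: if_splits)
  have v_inj: "j = k" if "v j = v k" "j < n" "k < n" for j k
  proof -
    have "map (\<lambda>d. att G (fst d) (snd d)) ds ! j = map (\<lambda>d. att G (fst d) (snd d)) ds ! k"
      using that tail[of j] tail[of k] by (simp add: n_def e_def i_def)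
    then show ?thesis
      using that nth_eq_iff_index_eq[OF dist, of j k] by (simp add: n_def)
  qed
  have e_inj: "j = k" if eq: "e j = e k" and less: "j < n" "k < n" for j k
  proof (rule ccontr)
    assume neq: "j \<noteq> k"
    have "i j \<noteq> i k"
    proof
      assume "i j = i k"
      then have "Some (v j) = Some (v k)" using tail[OF less(1)] tail[OF less(2)] eq by simp
      then show False using v_inj less neq by simp
    qed
    then have ij: "i k = (\<not> i j)" by auto
    \<comment> \<open>The shared edge is traversed in both directions, so each of the two steps follows the other.\<close>
    have "Some (v k) = Some (v (nxt j))"
      using tail[OF less(2)] head[OF less(1)] eq ij by simp
    then have "k = nxt j" using v_inj less(2) nxt_less by simp
    then have kj: "Suc j = n \<and> k = 0 \<or> k = Suc j"
      using nxt_eq[OF less(1)] by (simp split: if_splits)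
    have "Some (v j) = Some (v (nxt k))"
      using tail[OF less(1)] head[OF less(2)] eq ij by simp
    then have "j = nxt k" using v_inj less(1) nxt_less by simp
    then have jk: "Suc k = n \<and> j = 0 \<or> j = Suc k"
      using nxt_eq[OF less(2)] by (simp split: if_splits)
    have "n = 2 \<and> (j = 0 \<and> k = 1 \<or> j = 1 \<and> k = 0)"
      using neq less kj jk by linarith
    then have "length ds = 2" "e 0 = e 1"
      using eq by (auto simp: n_def)
    then have "walk_sign G ds = esign G (e 0) * esign G (e 0)"
      by (auto simp: e_def numeral_2_eq_2 length_Suc_conv)
    with edge[OF n0] sign show False
      by (auto dest!: esign_cases)
  qed
  define C where "C = \<lparr>vertices = v ` {..<n}, edges = e ` {..<n}, att = att G, esign = esign G\<rparr>"
  have ends: "x = v k \<and> j = i k \<or> x = v (nxt k) \<and> j = (\<not> i k)"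
    if "k < n" "att G (e k) j = Some x" for k j x
    using that tail head by (cases "j = i k") auto
  have "signed_graph C"
  proof
    show "x \<in> vertices C" if "f \<in> edges C" "att C f j = Some x" for f j x
    proof -
      obtain k where "k < n" "f = e k" "att G (e k) j = Some x"
        using \<open>f \<in> edges C\<close> \<open>att C f j = Some x\<close> by (auto simp: C_def)
      then have "x = v k \<or> x = v (nxt k)" using ends by blast
      then show ?thesis using \<open>k < n\<close> nxt_less by (auto simp: C_def)
    qed
    show "\<exists>j. att C f j \<noteq> None" if "f \<in> edges C" for f
      using that tail by (fastforce simp: C_def)
    show "esign C f \<in> {1, -1}" if "f \<in> edges C" for f
      using that edge esign_cases by (auto simp: C_def)
  qed (simp_all add: C_def)
  moreover have "vertices C \<subseteq> vertices G"
    using att_closed[OF edge tail] by (auto simp: C_def)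
  moreover have "edges C \<subseteq> edges G"
    using edge by (auto simp: C_def)
  ultimately have sub: "subgraph C G"
    by (simp add: subgraph_def C_def)
  have "connected_graph C"
  proof -
    have reach: "(v 0, v k) \<in> (adjacency C)\<^sup>*" if "k < n" for k
      using that
    proof (induction k)
      case (Suc k)
      then have "(v k, v (Suc k)) \<in> adjacency C"
        using tail[of k] head[of k] nxt_eq[of k]
        by (intro adjacencyI[of "e k" _ "i k"]) (auto simp: C_def)
      with Suc show ?case by (meson Suc_lessD rtrancl.rtrancl_into_rtrancl)
    qed simp
    have "(x, y) \<in> (adjacency C)\<^sup>*" if xy: "x \<in> vertices C" "y \<in> vertices C" for x y
    proof -
      have "(v 0, x) \<in> (adjacency C)\<^sup>*" "(v 0, y) \<in> (adjacency C)\<^sup>*"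
        using xy reach by (auto simp: C_def)
      then show ?thesis by (meson adjacency_rtrancl_sym rtrancl_trans)
    qed
    then show ?thesis
      using n0 by (auto simp: connected_graph_def C_def)
  qed
  moreover have "no_outer_edges C"
  proof -
    have "att G (e k) j \<noteq> None" if "k < n" for k j
      using that tail head by (cases "j = i k") auto
    then have "\<not> outer_edge C (e k)" if "k < n" for k
      using that unfolding outer_edge_def C_def by (metis (full_types) sgraph.select_convs(3))
    then show ?thesis
      by (auto simp: no_outer_edges_def C_def)
  qed
  moreover have "degree C x = 2" if "x \<in> vertices C" for x
  proof -
    obtain k where k: "k < n" "x = v k" using \<open>x \<in> vertices C\<close> by (auto simp: C_def)
    define p where "p = (if k = 0 then n - 1 else k - 1)"
    have p: "p < n" "nxt p = k" using k n0 nxt_eq[of p] by (auto simp: p_def)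
    have "{(f, j). f \<in> edges C \<and> att C f j = Some x} = {(e k, i k), (e p, \<not> i p)}"
      (is "?L = ?R")
    proof (intro equalityI subsetI)
      fix d assume "d \<in> ?L"
      then obtain q j where q: "q < n" "d = (e q, j)" "att G (e q) j = Some (v k)"
        by (auto simp: C_def k)
      from ends[OF q(1,3)] show "d \<in> ?R"
      proof (elim disjE conjE)
        assume "v k = v q" "j = i q"
        moreover from this have "k = q" using v_inj[of k q] k(1) q(1) by simp
        ultimately show ?thesis using q(2) by simp
      next
        assume *: "v k = v (nxt q)" "j = (\<not> i q)"
        then have "nxt q = nxt p" using v_inj[of k "nxt q"] k(1) nxt_less[of q] p(2) by simp
        then have "q = p"
          unfolding nxt_eq[OF p(1)] nxt_eq[OF q(1)] by (simp split: if_splits)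
        then show ?thesis using q * by simp
      qed
    next
      fix d assume "d \<in> ?R"
      then show "d \<in> ?L" using k p tail head by (auto simp: C_def)
    qed
    moreover have "(e k, i k) \<noteq> (e p, \<not> i p)"
      using e_inj[of k p] k p by auto
    ultimately show ?thesis by (simp add: degree_def)
  qed
  ultimately have "circle C"
    using \<open>signed_graph C\<close> by (simp add: circle_def)
  moreover have "circle_sign C = -1"
  proof -
    have "circle_sign C = (\<Prod>k<n. esign G (e k))"
      unfolding circle_sign_def C_def
      using e_inj by (simp add: prod.reindex inj_on_def)
    also have "\<dots> = walk_sign G ds"
      by (simp add: walk_sign_def prod.list_conv_set_nth n_def e_def atLeast0LessThan)
    finally show ?thesis using sign by simp
  qed
  ultimately show ?thesis using sub that by blast
qed

section \<open>Potentials\<close>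

text \<open>
  A potential is a switching function that makes every edge positive; the sign of
  a walk from \<open>u\<close> to \<open>v\<close> is then \<open>\<eta> u * \<eta> v\<close>.
\<close>

definition potential :: "('v \<Rightarrow> int) \<Rightarrow> bool" where
  "potential \<eta> \<longleftrightarrow> (\<forall>v\<in>vertices G. \<eta> v = 1 \<or> \<eta> v = -1) \<and>
     (\<forall>e\<in>edges G. \<forall>i u v. att G e i = Some u \<longrightarrow> att G e (\<not> i) = Some v \<longrightarrow>
        \<eta> u * \<eta> v = esign G e)"

lemma no_outer_edges_both_ends:
  assumes "no_outer_edges G" "e \<in> edges G"
  obtains u where "att G e i = Some u"
proof -
  have "att G e i \<noteq> None"
  proof
    assume none: "att G e i = None"
    have other: "j = (\<not> i)" if "att G e j \<noteq> None" for j
      using that none by (cases i; cases j) simp_all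
    obtain j where "att G e j \<noteq> None" using att_ex[OF assms(2)] by blast
    with other have "outer_edge G e"
      unfolding outer_edge_def by metis
    with assms show False by (simp add: no_outer_edges_def)
  qed
  with that show ?thesis by blast
qed

text \<open>
  The sign of a circle is the product of \<open>\<eta>\<close> over all its edge ends.  Grouped by vertices, this is the
  product of the squares \<open>\<eta>(v)\<^sup>2\<close>, since every vertex of a circle has degree 2.
\<close>

lemma potential_circle_positive:
  assumes pot: "potential \<eta>" and sub: "subgraph C G" and C: "circle C"
  shows "circle_sign C = 1"
proof -
  interpret C: signed_graph C using C by (simp add: circle_def)
  let ?end = "\<lambda>(e, i). the (att G e i)"
  have att: "att C = att G" "esign C = esign G" using sub by (simp_all add: subgraph_def)
  have both: "att G e i = Some (the (att G e i))" if e: "e \<in> edges C" for e i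
    using C.no_outer_edges_both_ends[OF _ e, of i] C by (metis att(1) circle_def option.sel)
  have "circle_sign C = (\<Prod>e\<in>edges C. \<Prod>i\<in>UNIV. \<eta> (?end (e, i)))"
    unfolding circle_sign_def
  proof (rule prod.cong[OF refl])
    fix e assume e: "e \<in> edges C"
    then have "e \<in> edges G" using sub by (auto simp: subgraph_def)
    moreover have "att G e True = Some (?end (e, True))" "att G e (\<not> True) = Some (?end (e, False))"
      using both[OF e] by simp_all
    ultimately have "\<eta> (?end (e, True)) * \<eta> (?end (e, False)) = esign G e"
      using pot unfolding potential_def by blast
    then show "esign C e = (\<Prod>i\<in>UNIV. \<eta> (?end (e, i)))"
      by (simp add: att UNIV_bool mult.commute)
  qed
  also have "\<dots> = (\<Prod>d\<in>edges C \<times> UNIV. \<eta> (?end d))"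
    by (simp add: prod.cartesian_product case_prod_unfold)
  also have "\<dots> = (\<Prod>v\<in>vertices C. \<Prod>d\<in>{d \<in> edges C \<times> UNIV. ?end d = v}. \<eta> (?end d))"
  proof (rule prod.group[symmetric])
    show "?end ` (edges C \<times> UNIV) \<subseteq> vertices C"
      using C.att_closed[unfolded att, OF _ both] by auto
  qed (simp_all add: C.finite_edges C.finite_vertices)
  also have "\<dots> = (\<Prod>v\<in>vertices C. 1)"
  proof (rule prod.cong[OF refl])
    fix v assume v: "v \<in> vertices C"
    have "att C e i = Some v \<longleftrightarrow> the (att G e i) = v" if "e \<in> edges C" for e i
      using both[OF that, of i] unfolding att by (metis option.sel)
    then have "{d \<in> edges C \<times> UNIV. ?end d = v} = {(e, i). e \<in> edges C \<and> att C e i = Some v}"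
      by (simp add: set_eq_iff split_paired_all) blast
    then have card: "card {d \<in> edges C \<times> UNIV. ?end d = v} = 2"
      using C v by (simp add: circle_def degree_def)
    have "(\<Prod>d\<in>{d \<in> edges C \<times> UNIV. ?end d = v}. \<eta> (?end d)) =
        (\<Prod>d\<in>{d \<in> edges C \<times> UNIV. ?end d = v}. \<eta> v)"
      by (rule prod.cong) auto
    also have "\<dots> = \<eta> v ^ 2"
      by (simp only: prod_constant card)
    also have "\<dots> = 1"
    proof -
      have "v \<in> vertices G" using v sub by (auto simp: subgraph_def)
      then have "\<eta> v = 1 \<or> \<eta> v = -1" using pot by (simp add: potential_def)
      then show ?thesis by (elim disjE) simp_all
    qed
    finally show "(\<Prod>d\<in>{d \<in> edges C \<times> UNIV. ?end d = v}. \<eta> (?end d)) = 1" .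
  qed
  finally show ?thesis by simp
qed

text \<open>
  Walking from the root to \<open>u\<close>, along an edge to \<open>v\<close>, and back to the root is a closed walk, so its sign
  \<open>w u * esign G e * w v\<close> is 1.
\<close>

lemma walk_signs_potential:
  assumes w: "\<And>v. v \<in> vertices G \<Longrightarrow> \<exists>ds. walk G v ds r \<and> walk_sign G ds = w v"
    and closed: "\<And>ds. walk G r ds r \<Longrightarrow> walk_sign G ds = 1"
  shows "potential w"
  unfolding potential_def
proof (intro conjI ballI allI impI)
  show "w v = 1 \<or> w v = -1" if "v \<in> vertices G" for v
    using w[OF that] walk_sign_cases by metis
  fix e i u v assume e: "e \<in> edges G" "att G e i = Some u" "att G e (\<not> i) = Some v"
  obtain ds where ds: "walk G u ds r" "walk_sign G ds = w u"
    using w att_closed e by blast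
  obtain es where es: "walk G v es r" "walk_sign G es = w v"
    using w att_closed e by blast
  have "walk G u ((e, i) # es) r" using e es by simp
  then have "walk G r (reverse_walk ds @ (e, i) # es) r"
    using walk_reverse[OF ds(1)] walk_append by metis
  from closed[OF this] have "w u * esign G e * w v = 1"
    using ds es by simp
  moreover have "w u = 1 \<or> w u = -1" "w v = 1 \<or> w v = -1"
    using walk_sign_cases ds es by metis+
  ultimately show "w u * w v = esign G e"
    using esign_cases[OF e(1)] by auto
qed

lemma balanced_walk_signs_potential:
  assumes "balanced G"
    and "\<And>v. v \<in> vertices G \<Longrightarrow> \<exists>ds. walk G v ds r \<and> walk_sign G ds = w v"
  shows "potential w"
proof (rule walk_signs_potential[OF assms(2)])
  fix ds assume ds: "walk G r ds r"
  show "walk_sign G ds = 1"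
  proof (rule ccontr)
    assume "walk_sign G ds \<noteq> 1"
    then have "walk_sign G ds = -1" using walk_sign_cases[OF ds] by blast
    then obtain C where "subgraph C G" "circle C" "circle_sign C = -1"
      using negative_closed_walk_circle[OF ds] by blast
    with assms(1) show False by (auto simp: balanced_def)
  qed
qed

text \<open>
  If all closed walks at \<open>r\<close> were positive, the signs of walks to \<open>r\<close> would form a potential, and a
  potential makes all circles positive.
\<close>

lemma unbalanced_negative_closed_walk:
  assumes "connected_graph G" "no_outer_edges G" "\<not> balanced G" "r \<in> vertices G"
  shows "\<exists>ds. walk G r ds r \<and> walk_sign G ds = -1"
proof (rule ccontr)
  assume neg: "\<nexists>ds. walk G r ds r \<and> walk_sign G ds = -1"
  have "\<exists>ds. walk G v ds r" if "v \<in> vertices G" for v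
    using that assms reachable_walk by (metis connected_graph_def)
  then obtain W where W: "\<And>v. v \<in> vertices G \<Longrightarrow> walk G v (W v) r"
    by metis
  have "potential (\<lambda>v. walk_sign G (W v))"
    by (rule walk_signs_potential[of r]) (use W neg walk_sign_cases in blast)+
  then have "balanced G"
    using potential_circle_positive assms(2) by (simp add: balanced_def)
  with assms(3) show False ..
qed

end

section \<open>Products of abelian groups and squares\<close>

lemma (in comm_group) hom_finprod:
  assumes "comm_group H" "h \<in> hom G H" "f \<in> S \<rightarrow> carrier G"
  shows "h (finprod G f S) = finprod H (\<lambda>s. h (f s)) S"
proof -
  interpret H: comm_group H by fact
  interpret h: group_hom G H h
    using assms(2) by (simp add: group_hom_def group_hom_axioms_def)
  show ?thesis
    using assms(3)
  proof (induction S rule: infinite_finite_induct)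
    case (insert x F)
    then have "f \<in> F \<rightarrow> carrier G" "f x \<in> carrier G" by auto
    moreover from this have "(\<lambda>s. h (f s)) \<in> F \<rightarrow> carrier H" by (simp add: Pi_iff)
    ultimately show ?case
      using insert by simp
  qed simp_all
qed

lemma (in comm_group) finprod_in_subgroup:
  assumes "subgroup K G" "f \<in> S \<rightarrow> K"
  shows "finprod G f S \<in> K"
  using assms(2)
proof (induction S rule: infinite_finite_induct)
  case (insert x F)
  then have "f \<in> F \<rightarrow> K" "f x \<in> K" by auto
  moreover from this have "f \<in> F \<rightarrow> carrier G" "f x \<in> carrier G"
    using subgroup.subset[OF assms(1)] by auto
  ultimately show ?case
    using insert subgroup.m_closed[OF assms(1)] by simp
qed (use subgroup.one_closed[OF assms(1)] in simp_all)

lemma product_group_comm: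
  assumes "\<And>i. i \<in> I \<Longrightarrow> comm_group (F i)"
  shows "comm_group (product_group I F)"
proof (rule group.group_comm_groupI)
  show "group (product_group I F)" using assms by (simp add: comm_group.axioms)
  show "x \<otimes>\<^bsub>product_group I F\<^esub> y = y \<otimes>\<^bsub>product_group I F\<^esub> x"
    if "x \<in> carrier (product_group I F)" "y \<in> carrier (product_group I F)" for x y
  proof -
    have "x i \<otimes>\<^bsub>F i\<^esub> y i = y i \<otimes>\<^bsub>F i\<^esub> x i" if "i \<in> I" for i
    proof -
      interpret F: comm_group "F i" using assms that .
      show ?thesis
        using \<open>i \<in> I\<close> \<open>x \<in> _\<close> \<open>y \<in> _\<close> by (intro F.m_comm) auto
    qed
    then show ?thesis by (simp cong: restrict_cong)
  qed
qed

lemma finprod_product_group: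
  assumes F: "\<And>i. i \<in> I \<Longrightarrow> comm_group (F i)"
    and f: "f \<in> S \<rightarrow> carrier (product_group I F)" and i: "i \<in> I"
  shows "finprod (product_group I F) f S i = finprod (F i) (\<lambda>s. f s i) S"
proof -
  interpret P: comm_group "product_group I F" using F by (rule product_group_comm)
  have "(\<lambda>x. x i) \<in> hom (product_group I F) (F i)"
    using i by (auto simp: hom_def)
  from P.hom_finprod[OF F[OF i] this f] show ?thesis .
qed

lemma hom_into_product_group:
  assumes "\<And>i. i \<in> I \<Longrightarrow> h i \<in> hom G (F i)"
  shows "(\<lambda>x. \<lambda>i\<in>I. h i x) \<in> hom G (product_group I F)"
proof (rule homI)
  show "(\<lambda>i\<in>I. h i x) \<in> carrier (product_group I F)" if "x \<in> carrier G" for x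
    using hom_in_carrier[OF assms that] by simp
  show "(\<lambda>i\<in>I. h i (x \<otimes>\<^bsub>G\<^esub> y)) = (\<lambda>i\<in>I. h i x) \<otimes>\<^bsub>product_group I F\<^esub> (\<lambda>i\<in>I. h i y)"
    if "x \<in> carrier G" "y \<in> carrier G" for x y
    using that by (auto simp: hom_mult[OF assms] intro!: restrict_ext)
qed

text \<open>
  In a group of exponent two a subgroup \<open>S\<close> and an element \<open>g\<close> outside it span just \<open>S\<close> together with
  the coset \<open>g S\<close>.  Sending \<open>g\<close> to any element \<open>h\<close> of exponent two therefore extends a homomorphism on \<open>S\<close>,
  and the extension stays injective if \<open>h\<close> lies outside the image of \<open>S\<close>.
\<close>

lemma extend_injective_hom_exponent_two:
  assumes G: "comm_group G" "\<And>x. x \<in> carrier G \<Longrightarrow> x \<otimes>\<^bsub>G\<^esub> x = \<one>\<^bsub>G\<^esub>"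
    and H: "comm_group H" "\<And>x. x \<in> carrier H \<Longrightarrow> x \<otimes>\<^bsub>H\<^esub> x = \<one>\<^bsub>H\<^esub>"
    and S: "subgroup S G" and f: "f \<in> S \<rightarrow> carrier H"
    and mult: "\<And>x y. x \<in> S \<Longrightarrow> y \<in> S \<Longrightarrow> f (x \<otimes>\<^bsub>G\<^esub> y) = f x \<otimes>\<^bsub>H\<^esub> f y"
    and inj: "inj_on f S"
    and g: "g \<in> carrier G" "g \<notin> S" and h: "h \<in> carrier H" "h \<notin> f ` S"
  obtains T f' where "subgroup T G" "S \<subset> T" "f' \<in> T \<rightarrow> carrier H"
    "\<And>x y. x \<in> T \<Longrightarrow> y \<in> T \<Longrightarrow> f' (x \<otimes>\<^bsub>G\<^esub> y) = f' x \<otimes>\<^bsub>H\<^esub> f' y" "inj_on f' T"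
proof -
  interpret G: comm_group G by fact
  interpret H: comm_group H by fact
  interpret S: subgroup S G by fact
  have SG: "s \<in> carrier G" if "s \<in> S" for s using that S.subset by blast
  have fH: "f s \<in> carrier H" if "s \<in> S" for s using that f by blast
  have gg: "g \<otimes>\<^bsub>G\<^esub> (g \<otimes>\<^bsub>G\<^esub> x) = x" if "x \<in> carrier G" for x
    using that g(1) G(2)[OF g(1)] by (simp flip: G.m_assoc)
  have hh: "h \<otimes>\<^bsub>H\<^esub> (h \<otimes>\<^bsub>H\<^esub> x) = x" if "x \<in> carrier H" for x
    using that h(1) H(2)[OF h(1)] by (simp flip: H.m_assoc)
  have gs: "g \<otimes>\<^bsub>G\<^esub> s \<notin> S" if s: "s \<in> S" for s
  proof
    assume "g \<otimes>\<^bsub>G\<^esub> s \<in> S"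
    then have "(g \<otimes>\<^bsub>G\<^esub> s) \<otimes>\<^bsub>G\<^esub> s \<in> S" using s by simp
    moreover have "(g \<otimes>\<^bsub>G\<^esub> s) \<otimes>\<^bsub>G\<^esub> s = g"
      using g(1) SG[OF s] G(2)[OF SG[OF s]] by (simp add: G.m_assoc)
    ultimately show False using g(2) by simp
  qed
  define T where "T = S \<union> (\<lambda>s. g \<otimes>\<^bsub>G\<^esub> s) ` S"
  define f' where "f' x = (if x \<in> S then f x else h \<otimes>\<^bsub>H\<^esub> f (g \<otimes>\<^bsub>G\<^esub> x))" for x
  have f'S: "f' s = f s" and f'g: "f' (g \<otimes>\<^bsub>G\<^esub> s) = h \<otimes>\<^bsub>H\<^esub> f s" if "s \<in> S" for s
    using that gs gg[OF SG] by (simp_all add: f'_def)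
  have T_cases: thesis
    if "x \<in> T" "\<And>s. s \<in> S \<Longrightarrow> x = s \<Longrightarrow> thesis" "\<And>s. s \<in> S \<Longrightarrow> x = g \<otimes>\<^bsub>G\<^esub> s \<Longrightarrow> thesis" for x thesis
    using that unfolding T_def by blast
  have TG: "x \<in> carrier G" if "x \<in> T" for x
    using that g(1) SG by (auto simp: T_def)
  have prods: "s \<otimes>\<^bsub>G\<^esub> (g \<otimes>\<^bsub>G\<^esub> t) = g \<otimes>\<^bsub>G\<^esub> (s \<otimes>\<^bsub>G\<^esub> t)"
    "(g \<otimes>\<^bsub>G\<^esub> s) \<otimes>\<^bsub>G\<^esub> t = g \<otimes>\<^bsub>G\<^esub> (s \<otimes>\<^bsub>G\<^esub> t)"
    "(g \<otimes>\<^bsub>G\<^esub> s) \<otimes>\<^bsub>G\<^esub> (g \<otimes>\<^bsub>G\<^esub> t) = s \<otimes>\<^bsub>G\<^esub> t" if "s \<in> S" "t \<in> S" for s t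
  proof -
    note [simp] = g(1) SG[OF that(1)] SG[OF that(2)]
    show 1: "s \<otimes>\<^bsub>G\<^esub> (g \<otimes>\<^bsub>G\<^esub> t) = g \<otimes>\<^bsub>G\<^esub> (s \<otimes>\<^bsub>G\<^esub> t)" by (simp add: G.m_lcomm)
    show "(g \<otimes>\<^bsub>G\<^esub> s) \<otimes>\<^bsub>G\<^esub> t = g \<otimes>\<^bsub>G\<^esub> (s \<otimes>\<^bsub>G\<^esub> t)" by (simp add: G.m_assoc)
    show "(g \<otimes>\<^bsub>G\<^esub> s) \<otimes>\<^bsub>G\<^esub> (g \<otimes>\<^bsub>G\<^esub> t) = s \<otimes>\<^bsub>G\<^esub> t"
      by (simp add: G.m_assoc 1 gg)
  qed
  have prodsH: "f s \<otimes>\<^bsub>H\<^esub> (h \<otimes>\<^bsub>H\<^esub> f t) = h \<otimes>\<^bsub>H\<^esub> (f s \<otimes>\<^bsub>H\<^esub> f t)"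
    "(h \<otimes>\<^bsub>H\<^esub> f s) \<otimes>\<^bsub>H\<^esub> f t = h \<otimes>\<^bsub>H\<^esub> (f s \<otimes>\<^bsub>H\<^esub> f t)"
    "(h \<otimes>\<^bsub>H\<^esub> f s) \<otimes>\<^bsub>H\<^esub> (h \<otimes>\<^bsub>H\<^esub> f t) = f s \<otimes>\<^bsub>H\<^esub> f t" if "s \<in> S" "t \<in> S" for s t
  proof -
    note [simp] = h(1) fH[OF that(1)] fH[OF that(2)]
    show 1: "f s \<otimes>\<^bsub>H\<^esub> (h \<otimes>\<^bsub>H\<^esub> f t) = h \<otimes>\<^bsub>H\<^esub> (f s \<otimes>\<^bsub>H\<^esub> f t)" by (simp add: H.m_lcomm)
    show "(h \<otimes>\<^bsub>H\<^esub> f s) \<otimes>\<^bsub>H\<^esub> f t = h \<otimes>\<^bsub>H\<^esub> (f s \<otimes>\<^bsub>H\<^esub> f t)" by (simp add: H.m_assoc)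
    show "(h \<otimes>\<^bsub>H\<^esub> f s) \<otimes>\<^bsub>H\<^esub> (h \<otimes>\<^bsub>H\<^esub> f t) = f s \<otimes>\<^bsub>H\<^esub> f t"
      by (simp add: H.m_assoc 1 hh)
  qed
  have sep: "f s \<noteq> h \<otimes>\<^bsub>H\<^esub> f t" if st: "s \<in> S" "t \<in> S" for s t
  proof
    assume "f s = h \<otimes>\<^bsub>H\<^esub> f t"
    then have "f s \<otimes>\<^bsub>H\<^esub> f t = h \<otimes>\<^bsub>H\<^esub> (f t \<otimes>\<^bsub>H\<^esub> f t)"
      using fH[OF st(2)] h(1) by (simp add: H.m_assoc)
    then have "h = f (s \<otimes>\<^bsub>G\<^esub> t)"
      using fH[OF st(2)] h(1) H(2) mult[OF st] by simp
    with st h(2) show False by simp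
  qed
  show ?thesis
  proof (rule that)
    show "subgroup T G"
    proof (rule G.subgroupI)
      show "T \<subseteq> carrier G" using TG by blast
      show "T \<noteq> {}" using S.one_closed unfolding T_def by blast
      show "inv\<^bsub>G\<^esub> x \<in> T" if "x \<in> T" for x
        using that G.inv_equality[OF G(2) TG TG] TG by simp
      show "x \<otimes>\<^bsub>G\<^esub> y \<in> T" if "x \<in> T" "y \<in> T" for x y
        by (rule T_cases[OF that(1)]; rule T_cases[OF that(2)]; simp add: prods)
          (simp_all add: T_def)
    qed
    have "g \<in> T"
      using imageI[OF S.one_closed, of "\<lambda>s. g \<otimes>\<^bsub>G\<^esub> s"] g(1) by (simp add: T_def)
    then show "S \<subset> T" using g(2) unfolding T_def by blast
    show "f' \<in> T \<rightarrow> carrier H"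
    proof
      fix x assume "x \<in> T"
      then show "f' x \<in> carrier H"
        by (rule T_cases) (simp_all add: f'S f'g fH h(1))
    qed
    show "f' (x \<otimes>\<^bsub>G\<^esub> y) = f' x \<otimes>\<^bsub>H\<^esub> f' y" if "x \<in> T" "y \<in> T" for x y
      by (rule T_cases[OF that(1)]; rule T_cases[OF that(2)];
          simp add: prods prodsH f'S f'g mult)
    show "inj_on f' T"
    proof (rule inj_onI)
      fix x y assume "x \<in> T" "y \<in> T" "f' x = f' y"
      then show "x = y"
        by (elim T_cases) (auto simp: f'S f'g h(1) fH sep sep[symmetric] inj_on_eq_iff[OF inj])
    qed
  qed
qed

text \<open>
  Two vector spaces over the field with two elements are isomorphic if they have equally many elements.
  Instead of choosing bases, take an injective homomorphism defined on a subgroup of \<open>G\<close> of largest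
  possible order; by the previous lemma it can be extended as long as its domain is not all of \<open>G\<close>.
\<close>

lemma exponent_two_iso:
  assumes G: "comm_group G" "\<And>x. x \<in> carrier G \<Longrightarrow> x \<otimes>\<^bsub>G\<^esub> x = \<one>\<^bsub>G\<^esub>"
    and H: "comm_group H" "\<And>x. x \<in> carrier H \<Longrightarrow> x \<otimes>\<^bsub>H\<^esub> x = \<one>\<^bsub>H\<^esub>"
    and fin: "finite (carrier G)" "finite (carrier H)" and card: "card (carrier G) = card (carrier H)"
  shows "G \<cong> H"
proof -
  interpret G: comm_group G by fact
  interpret H: comm_group H by fact
  define P where "P = (\<lambda>(S, f). subgroup S G \<and> f \<in> S \<rightarrow> carrier H \<and> inj_on f S \<and>
    (\<forall>x\<in>S. \<forall>y\<in>S. f (x \<otimes>\<^bsub>G\<^esub> y) = f x \<otimes>\<^bsub>H\<^esub> f y))"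
  have "P ({\<one>\<^bsub>G\<^esub>}, \<lambda>_. \<one>\<^bsub>H\<^esub>)"
    by (simp add: P_def G.triv_subgroup)
  moreover have "\<forall>p. P p \<longrightarrow> card (fst p) < Suc (card (carrier G))"
    using fin by (auto simp: P_def less_Suc_eq_le intro!: card_mono dest: subgroup.subset)
  ultimately have "\<exists>p. P p \<and> (\<forall>q. P q \<longrightarrow> card (fst q) \<le> card (fst p))"
    by (rule Lattices_Big.ex_has_greatest_nat)
  then obtain p where p: "P p" "\<And>q. P q \<Longrightarrow> card (fst q) \<le> card (fst p)" by blast
  obtain S f where Sf: "p = (S, f)" by (cases p)
  have S: "subgroup S G" and f: "f \<in> S \<rightarrow> carrier H" and inj: "inj_on f S"
    and mult: "\<And>x y. x \<in> S \<Longrightarrow> y \<in> S \<Longrightarrow> f (x \<otimes>\<^bsub>G\<^esub> y) = f x \<otimes>\<^bsub>H\<^esub> f y"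
    using p(1) by (simp_all add: Sf P_def)
  have sub: "S \<subseteq> carrier G" by (rule subgroup.subset[OF S])
  have "S = carrier G"
  proof (rule ccontr)
    assume "S \<noteq> carrier G"
    with sub obtain g where g: "g \<in> carrier G" "g \<notin> S" by blast
    have "S \<subset> carrier G" using g sub by blast
    then have "card (f ` S) < card (carrier H)"
      using psubset_card_mono[OF fin(1)] by (simp add: card_image[OF inj] card)
    then have "f ` S \<noteq> carrier H" by auto
    then obtain h where h: "h \<in> carrier H" "h \<notin> f ` S" using f by blast
    obtain T f' where T: "subgroup T G" "S \<subset> T" "f' \<in> T \<rightarrow> carrier H"
      "\<And>x y. x \<in> T \<Longrightarrow> y \<in> T \<Longrightarrow> f' (x \<otimes>\<^bsub>G\<^esub> y) = f' x \<otimes>\<^bsub>H\<^esub> f' y" "inj_on f' T"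
      by (rule extend_injective_hom_exponent_two[OF G H S f mult inj g h]) (assumption+, rule that)
    then have "P (T, f')" by (simp add: P_def)
    then have "card T \<le> card S" using p(2)[of "(T, f')"] by (simp add: Sf)
    moreover have "finite T" using subgroup.subset[OF T(1)] fin(1) by (rule finite_subset)
    ultimately show False using psubset_card_mono[OF _ T(2)] by simp
  qed
  note f' = f[unfolded this] and inj' = inj[unfolded this] and mult' = mult[unfolded this]
  have "f ` carrier G = carrier H"
  proof (rule card_subset_eq[OF fin(2)])
    show "f ` carrier G \<subseteq> carrier H" using f' by blast
    show "card (f ` carrier G) = card (carrier H)" using card by (simp add: card_image[OF inj'])
  qed
  then have "f \<in> iso G H"
    using f' inj' mult' by (simp add: iso_def hom_def bij_betw_def)
  then show ?thesis by (rule is_isoI)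
qed

context comm_group
begin

lemma square_hom: "(\<lambda>a. a [^] (2::nat)) \<in> hom G G"
  by (rule homI) (simp_all add: nat_pow_distrib)

lemma square_group_hom: "group_hom G G (\<lambda>a. a [^] (2::nat))"
  using square_hom by (simp add: group_hom_def group_hom_axioms_def)

lemma doubles_eq_image: "doubles G = (\<lambda>a. a [^] (2::nat)) ` carrier G"
  by (auto simp: doubles_def)

lemma doubles_subgroup: "subgroup (doubles G) G"
  unfolding doubles_eq_image by (rule group_hom.img_is_subgroup[OF square_group_hom])

lemma doubles_normal: "doubles G \<lhd> G"
  using doubles_subgroup by (rule subgroup_imp_normal)

lemma tor2_subgroup: "subgroup (carrier (tor2 G)) G"
  using group_hom.subgroup_kernel[OF square_group_hom] by (simp add: kernel_def tor2_def)

lemma tor2_eq: "tor2 G = G\<lparr>carrier := carrier (tor2 G)\<rparr>"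
  by (simp add: tor2_def)

lemma tor2_comm_group: "comm_group (tor2 G)"
proof (rule group.group_comm_groupI)
  show "group (tor2 G)"
    by (subst tor2_eq) (rule subgroup_imp_group[OF tor2_subgroup])
qed (simp_all add: tor2_def m_comm)

lemma Mod_doubles_comm_group: "comm_group (G Mod doubles G)"
  by (rule abelian_FactGroup[OF doubles_subgroup])

text \<open>
  Squaring has image \<open>doubles G\<close> and kernel \<open>tor2 G\<close>, so both counts equal \<open>order G / card (doubles G)\<close>.
\<close>

lemma card_doubles_cosets:
  assumes "finite (carrier G)"
  shows "card (rcosets (doubles G)) = card (carrier (tor2 G))"
proof -
  let ?D = "G\<lparr>carrier := doubles G\<rparr>"
  have ker: "kernel G ?D (\<lambda>a. a [^] (2::nat)) = carrier (tor2 G)"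
    by (simp add: kernel_def tor2_def)
  have "group ?D" by (rule subgroup_imp_group[OF doubles_subgroup])
  then have "group_hom G ?D (\<lambda>a. a [^] (2::nat))"
    using square_hom by (auto simp: group_hom_def group_hom_axioms_def hom_def doubles_eq_image)
  from group_hom.FactGroup_iso[OF this] have "G Mod carrier (tor2 G) \<cong> ?D"
    unfolding ker by (simp add: doubles_eq_image)
  then have "card (rcosets (carrier (tor2 G))) = card (doubles G)"
    by (drule_tac iso_same_card) (simp add: FactGroup_def)
  then have "card (doubles G) * card (carrier (tor2 G)) = order G"
    using lagrange[OF tor2_subgroup] by simp
  moreover have "card (rcosets (doubles G)) * card (doubles G) = order G"
    by (rule lagrange[OF doubles_subgroup])
  moreover have "card (doubles G) \<noteq> 0"
  proof -
    have "finite (doubles G)" using assms by (simp add: doubles_eq_image)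
    then show ?thesis using subgroup.one_closed[OF doubles_subgroup] card_0_eq by blast
  qed
  ultimately show ?thesis
    by (metis mult.commute mult_cancel1)
qed

text \<open>
  The natural map from \<open>tor2 G\<close> to \<open>G Mod doubles G\<close> need not be bijective; for a cyclic group of order 4
  it is trivial.  The groups are isomorphic because both have exponent two and the same order.
\<close>

lemma Mod_doubles_iso_tor2:
  assumes fin: "finite (carrier G)"
  shows "G Mod doubles G \<cong> tor2 G"
proof (rule exponent_two_iso[OF Mod_doubles_comm_group _ tor2_comm_group])
  show "x \<otimes>\<^bsub>G Mod doubles G\<^esub> x = \<one>\<^bsub>G Mod doubles G\<^esub>" if "x \<in> carrier (G Mod doubles G)" for x
  proof -
    obtain a where a: "a \<in> carrier G" "x = doubles G #> a"
      using \<open>x \<in> carrier (G Mod doubles G)\<close> by (auto simp: FactGroup_def RCOSETS_def)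
    have "x \<otimes>\<^bsub>G Mod doubles G\<^esub> x = doubles G #> (a \<otimes> a)"
      using a normal.rcos_sum[OF doubles_normal] by (simp add: FactGroup_def)
    moreover have "a \<otimes> a \<in> doubles G"
      using a(1) by (auto simp: doubles_def numeral_2_eq_2 intro!: exI[of _ a])
    then have "doubles G #> (a \<otimes> a) = doubles G"
      using a(1) doubles_subgroup by (intro coset_join2) auto
    ultimately show ?thesis by (simp add: FactGroup_def)
  qed
  show "x \<otimes>\<^bsub>tor2 G\<^esub> x = \<one>\<^bsub>tor2 G\<^esub>" if "x \<in> carrier (tor2 G)" for x
    using that by (auto simp: tor2_def numeral_2_eq_2)
  show "finite (carrier (G Mod doubles G))" "finite (carrier (tor2 G))"
    using fin by (simp_all add: FactGroup_def RCOSETS_def tor2_def)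
  show "card (carrier (G Mod doubles G)) = card (carrier (tor2 G))"
    using card_doubles_cosets[OF fin] by (simp add: FactGroup_def)
qed

end

section \<open>Boundaries\<close>

locale signed_graph_coefficients = signed_graph G + A: comm_group A
  for G :: "('v, 'e) sgraph" and A :: "('a, 'm) monoid_scheme" (structure)
begin

abbreviation "C0 \<equiv> chain0 G A"
abbreviation "C1 \<equiv> chain1 G A"
abbreviation "B0 \<equiv> boundary G A ` carrier C1"

sublocale C0: comm_group C0
  by (rule chain0_comm_group) (rule A.comm_group_axioms)

lemma chain0_closed: "x \<in> carrier C0 \<Longrightarrow> v \<in> vertices G \<Longrightarrow> x v \<in> carrier A"
  by (auto simp: chain0_def)

lemma chain0_eqI:
  assumes "x \<in> carrier C0" "y \<in> carrier C0" "\<And>v. v \<in> vertices G \<Longrightarrow> x v = y v"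
  shows "x = y"
  using assms(1,2) by (auto simp: chain0_def intro: PiE_ext assms(3))

lemma chain0_mult: "v \<in> vertices G \<Longrightarrow> (x \<otimes>\<^bsub>C0\<^esub> y) v = x v \<otimes> y v"
  by (simp add: chain0_def)

lemma chain0_finprod:
  assumes "f \<in> S \<rightarrow> carrier C0" "v \<in> vertices G"
  shows "finprod C0 f S v = finprod A (\<lambda>s. f s v) S"
  unfolding chain0_def
  by (rule finprod_product_group[OF A.comm_group_axioms assms[unfolded chain0_def]])

definition single :: "'v \<Rightarrow> 'a \<Rightarrow> 'v \<Rightarrow> 'a" where
  "single v a = (\<lambda>u\<in>vertices G. if u = v then a else \<one>)"

lemma single_hom: "single v \<in> hom A C0"
  by (rule homI) (auto simp: single_def chain0_def)

lemma single_closed: "a \<in> carrier A \<Longrightarrow> single v a \<in> carrier C0"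
  using single_hom by (rule hom_in_carrier)

lemma chain0_eq_finprod_single:
  assumes "x \<in> carrier C0"
  shows "x = finprod C0 (\<lambda>v. single v (x v)) (vertices G)"
proof (rule chain0_eqI)
  have s: "(\<lambda>v. single v (x v)) \<in> vertices G \<rightarrow> carrier C0"
    using chain0_closed[OF assms] single_closed by blast
  then show "finprod C0 (\<lambda>v. single v (x v)) (vertices G) \<in> carrier C0"
    by simp
  fix u assume u: "u \<in> vertices G"
  have "finprod C0 (\<lambda>v. single v (x v)) (vertices G) u =
      finprod A (\<lambda>v. single v (x v) u) (vertices G)"
    by (rule chain0_finprod[OF s u])
  also have "\<dots> = finprod A (\<lambda>v. if u = v then x v else \<one>) (vertices G)"
    using u by (simp add: single_def)
  also have "\<dots> = x u"
    using u finite_vertices chain0_closed[OF assms] by (intro A.finprod_singleton) auto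
  finally show "x u = finprod C0 (\<lambda>v. single v (x v)) (vertices G) u" ..
qed (rule assms)

text \<open>
  The contribution of one end of an edge to a boundary.  An end attached to no vertex contributes the
  neutral chain, so that links, loops and outer-edges can be treated alike.
\<close>

definition half :: "'e \<Rightarrow> bool \<Rightarrow> 'a \<Rightarrow> 'v \<Rightarrow> 'a" where
  "half e i a = (case att G e i of None \<Rightarrow> \<one>\<^bsub>C0\<^esub> | Some u \<Rightarrow> single u a)"

lemma half_closed: "a \<in> carrier A \<Longrightarrow> half e i a \<in> carrier C0"
  by (simp add: half_def single_closed split: option.split)

lemma half_one: "half e i \<one> = \<one>\<^bsub>C0\<^esub>"
  by (simp add: half_def single_def chain0_def split: option.split)

lemma half_at: "v \<in> vertices G \<Longrightarrow> half e i a v = (if att G e i = Some v then a else \<one>)"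
  by (auto simp: half_def single_def chain0_def split: option.split)

text \<open>
  The boundary of the 1-chain with value \<open>a\<close> on the arc \<open>d\<close>, the inverse of \<open>a\<close> on the opposite arc, and
  the neutral element elsewhere.
\<close>

definition edge_boundary :: "'e \<times> (bool \<Rightarrow> int) \<Rightarrow> 'a \<Rightarrow> 'v \<Rightarrow> 'a" where
  "edge_boundary d a =
     half (fst d) True (a [^] snd d True) \<otimes>\<^bsub>C0\<^esub> half (fst d) False (a [^] snd d False)"

lemma edge_boundary_closed: "a \<in> carrier A \<Longrightarrow> edge_boundary d a \<in> carrier C0"
  by (simp add: edge_boundary_def half_closed)

lemma edge_boundary_one: "edge_boundary d \<one> = \<one>\<^bsub>C0\<^esub>"
  by (simp add: edge_boundary_def half_one)

text \<open>
  Counting each end separately reproduces the values of \<open>bracket\<close> on loops: the two arrows of a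
  negative loop agree at its vertex and add up to \<open>\<plusminus>2\<close>, those of a positive loop cancel.
\<close>

lemma bracket_eq_sum:
  assumes "(e, t) \<in> arcs G"
  shows "bracket G v (e, t) = (if att G e True = Some v then t True else 0) +
    (if att G e False = Some v then t False else 0)"
proof -
  have loop: "loop_at G e v \<longleftrightarrow> att G e True = Some v \<and> att G e False = Some v"
    unfolding loop_at_def by (metis (full_types))
  have e: "e \<in> edges G" and t: "t True = 1 \<or> t True = -1" "t False = 1 \<or> t False = -1"
    "t True * t False = - esign G e"
    using assms by (simp_all add: arcs_def)
  show ?thesis
    using t esign_cases[OF e] by (auto simp: bracket_def loop)
qed

lemma edge_boundary_at:
  assumes "d \<in> arcs G" "a \<in> carrier A" "v \<in> vertices G"
  shows "edge_boundary d a v = a [^] bracket G v d"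
proof -
  obtain e t where d: "d = (e, t)" by (cases d)
  show ?thesis
    using assms(2,3) bracket_eq_sum[OF assms(1)[unfolded d], of v]
    by (simp add: d edge_boundary_def chain0_mult half_at A.int_pow_mult)
qed

lemma chain1_closed: "c \<in> carrier C1 \<Longrightarrow> d \<in> arcs G \<Longrightarrow> c d \<in> carrier A"
  by (auto simp: chain1_def)

lemma boundary_eq_finprod:
  assumes c: "c \<in> carrier C1"
  shows "boundary G A c = finprod C0 (\<lambda>e. edge_boundary (orient G e) (c (orient G e))) (edges G)"
proof (rule chain0_eqI)
  have cl: "c (orient G e) \<in> carrier A" if "e \<in> edges G" for e
    using chain1_closed[OF c orient_arc(1)[OF that]] .
  have s: "(\<lambda>e. edge_boundary (orient G e) (c (orient G e))) \<in> edges G \<rightarrow> carrier C0"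
    using cl edge_boundary_closed by blast
  then show "finprod C0 (\<lambda>e. edge_boundary (orient G e) (c (orient G e))) (edges G) \<in> carrier C0"
    by simp
  show "boundary G A c \<in> carrier C0"
    using boundary_hom[OF A.comm_group_axioms] c by (rule hom_in_carrier)
  fix v assume v: "v \<in> vertices G"
  show "boundary G A c v =
      finprod C0 (\<lambda>e. edge_boundary (orient G e) (c (orient G e))) (edges G) v"
    unfolding chain0_finprod[OF s v]
    using v cl edge_boundary_at[OF orient_arc(1) cl v]
    by (auto simp: boundary_def intro!: A.finprod_cong')
qed

text \<open>
  In the boundary of the 1-chain supported on the two arcs of \<open>e\<close>, only the factor for \<open>e\<close> is not neutral.
\<close>

lemma edge_boundary_in_image:
  assumes e: "e \<in> edges G" and a: "a \<in> carrier A"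
  shows "edge_boundary (orient G e) a \<in> B0"
proof
  let ?o = "orient G e"
  define c where "c = (\<lambda>d\<in>arcs G. if d = ?o then a else if d = arc_inv ?o then inv a else \<one>)"
  note o = orient_arc[OF e]
  have invo: "arc_inv (arc_inv d) = d" for d :: "'e \<times> (bool \<Rightarrow> int)"
    by (simp add: arc_inv_def)
  have "c (arc_inv d) = inv c d" if d: "d \<in> arcs G" for d
  proof -
    have "arc_inv d = ?o \<longleftrightarrow> d = arc_inv ?o" "arc_inv d = arc_inv ?o \<longleftrightarrow> d = ?o"
      by (metis invo)+
    then show ?thesis
      using a d arc_inv_closed[OF d] arc_inv_neq[OF o(1)] by (simp add: c_def)
  qed
  then show c: "c \<in> carrier C1"
    using a by (simp add: chain1_def c_def)
  have "edge_boundary (orient G f) (c (orient G f)) = (if e = f then edge_boundary ?o a else \<one>\<^bsub>C0\<^esub>)"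
    if f: "f \<in> edges G" for f
  proof (cases "e = f")
    case True then show ?thesis using o by (simp add: c_def)
  next
    case False
    then have "orient G f \<noteq> ?o" "orient G f \<noteq> arc_inv ?o"
      using orient_arc(2)[OF f] o(2) by (auto simp: arc_inv_def)
    then show ?thesis using False orient_arc(1)[OF f] by (simp add: c_def edge_boundary_one)
  qed
  then have "boundary G A c = finprod C0 (\<lambda>f. if e = f then edge_boundary ?o a else \<one>\<^bsub>C0\<^esub>) (edges G)"
    unfolding boundary_eq_finprod[OF c]
    using edge_boundary_closed[OF a] by (intro C0.finprod_cong') auto
  also have "\<dots> = edge_boundary ?o a"
    using e finite_edges edge_boundary_closed[OF a] by (intro C0.finprod_singleton) auto
  finally show "edge_boundary ?o a = boundary G A c" ..
qed

text \<open>
  The relation imposed by a single edge does not depend on its orientation: raising \<open>a\<close> to the arrow at the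
  end \<open>i\<close> removes the arrows and leaves only the edge sign.
\<close>

lemma half_relation:
  assumes e: "e \<in> edges G" and a: "a \<in> carrier A"
  shows "half e i a \<otimes>\<^bsub>C0\<^esub> half e (\<not> i) (a [^] (- esign G e)) \<in> B0"
proof -
  obtain t where o: "orient G e = (e, t)" using orient_arc(2)[OF e] by (cases "orient G e") simp
  then have t: "t True * t False = - esign G e" "\<And>i. t i = 1 \<or> t i = -1"
    using orient_arc(1)[OF e] by (simp_all add: arcs_def)
  have tt: "t j * t j = 1" for j using t(2)[of j] by auto
  have "edge_boundary (orient G e) (a [^] t i) \<in> B0"
    using e a by (intro edge_boundary_in_image) simp_all
  moreover have "edge_boundary (orient G e) (a [^] t i) =
      half e i a \<otimes>\<^bsub>C0\<^esub> half e (\<not> i) (a [^] (- esign G e))"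
  proof (cases i)
    case True
    then show ?thesis
      using a by (simp add: o edge_boundary_def A.int_pow_pow tt t(1))
  next
    case False
    have "edge_boundary (orient G e) (a [^] t i) = half e True (a [^] (- esign G e)) \<otimes>\<^bsub>C0\<^esub> half e False a"
      using a False by (simp add: o edge_boundary_def A.int_pow_pow tt t(1)[symmetric] mult.commute)
    then show ?thesis
      using a False by (simp add: C0.m_comm half_closed)
  qed
  ultimately show ?thesis by simp
qed

section \<open>Classes of one-vertex chains\<close>

abbreviation "H0 \<equiv> homology0 G A"

lemma boundaries_subgroup: "subgroup B0 C0"
proof -
  interpret group_hom C1 C0 "boundary G A"
    using chain0_comm_group[OF A.comm_group_axioms] chain1_comm_group[OF A.comm_group_axioms]
      boundary_hom[OF A.comm_group_axioms]
    by (simp add: group_hom_def group_hom_axioms_def comm_group.axioms)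
  show ?thesis by (rule img_is_subgroup)
qed

sublocale H0: comm_group H0
  by (rule homology0_comm_group) (rule A.comm_group_axioms)

definition cls :: "('v \<Rightarrow> 'a) \<Rightarrow> ('v \<Rightarrow> 'a) set" where
  "cls x = B0 #>\<^bsub>C0\<^esub> x"

lemma cls_hom: "cls \<in> hom C0 H0"
  unfolding cls_def homology0_def
  by (rule normal.r_coset_hom_Mod[OF C0.subgroup_imp_normal[OF boundaries_subgroup]])

lemma cls_eq_one_iff: "x \<in> carrier C0 \<Longrightarrow> cls x = \<one>\<^bsub>H0\<^esub> \<longleftrightarrow> x \<in> B0"
  using C0.coset_join1[OF _ _ boundaries_subgroup, of x] C0.coset_join2[OF _ boundaries_subgroup, of x]
  by (auto simp: cls_def homology0_def FactGroup_def)

text \<open>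
  The homology class of the chain with value \<open>a\<close> at \<open>v\<close>.  These classes generate the homology group,
  and the lemmas below describe how they move along edges.
\<close>

definition vclass :: "'v \<Rightarrow> 'a \<Rightarrow> ('v \<Rightarrow> 'a) set" where
  "vclass v a = cls (single v a)"

lemma vclass_hom: "vclass v \<in> hom A H0"
  using hom_compose[OF single_hom cls_hom, of v] by (simp add: vclass_def[abs_def] comp_def)

lemma vclass_group_hom: "group_hom A H0 (vclass v)"
  using vclass_hom by (simp add: group_hom_def group_hom_axioms_def)

lemma vclass_edge:
  assumes e: "e \<in> edges G" "att G e i = Some u" "att G e (\<not> i) = Some v" and a: "a \<in> carrier A"
  shows "vclass u a = vclass v (a [^] esign G e)"
proof -
  interpret v: group_hom A H0 "vclass v" by (rule vclass_group_hom)
  interpret u: group_hom A H0 "vclass u" by (rule vclass_group_hom)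
  have "single u a \<otimes>\<^bsub>C0\<^esub> single v (a [^] (- esign G e)) \<in> B0"
    using half_relation[OF e(1) a, of i] e(2,3) by (simp add: half_def)
  then have "cls (single u a \<otimes>\<^bsub>C0\<^esub> single v (a [^] (- esign G e))) = \<one>\<^bsub>H0\<^esub>"
    using a by (subst cls_eq_one_iff) (simp_all add: single_closed)
  then have "vclass u a \<otimes>\<^bsub>H0\<^esub> vclass v (inv (a [^] esign G e)) = \<one>\<^bsub>H0\<^esub>"
    using a hom_mult[OF cls_hom] by (simp add: single_closed vclass_def A.int_pow_neg)
  then have "vclass u a \<otimes>\<^bsub>H0\<^esub> inv\<^bsub>H0\<^esub> vclass v (a [^] esign G e) = \<one>\<^bsub>H0\<^esub>"
    using a by simp
  then show ?thesis
    using a by (simp add: H0.inv_solve_right')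
qed

lemma vclass_outer:
  assumes e: "e \<in> edges G" "att G e i = Some u" "att G e (\<not> i) = None" and a: "a \<in> carrier A"
  shows "vclass u a = \<one>\<^bsub>H0\<^esub>"
proof -
  have "single u a \<in> B0"
    using half_relation[OF e(1) a, of i] e(2,3) single_closed[OF a] by (simp add: half_def)
  then show ?thesis
    unfolding vclass_def using a by (subst cls_eq_one_iff) (simp_all add: single_closed)
qed

text \<open>
  An edge carries a class to its other end at the price of the edge sign, so a walk carries it along at
  the price of the walk sign.  Hence the class at a root that admits a negative closed walk equals its
  own inverse.
\<close>

lemma vclass_walk:
  assumes "walk G u ds v" "a \<in> carrier A"
  shows "vclass u a = vclass v (a [^] walk_sign G ds)"
  using assms
proof (induction ds arbitrary: u a)
  case Nil
  then show ?case by simp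
next
  case (Cons d ds)
  from Cons.prems(1) obtain x where d: "fst d \<in> edges G" "att G (fst d) (snd d) = Some u"
    "att G (fst d) (\<not> snd d) = Some x" and w: "walk G x ds v"
    by auto
  have "vclass u a = vclass x (a [^] esign G (fst d))"
    by (rule vclass_edge[OF d Cons.prems(2)])
  also have "\<dots> = vclass v ((a [^] esign G (fst d)) [^] walk_sign G ds)"
    using Cons.prems(2) by (intro Cons.IH[OF w]) simp
  finally show ?case using Cons.prems(2) by (simp add: A.int_pow_pow)
qed

section \<open>Component invariants\<close>

definition root :: "('v, 'e) sgraph \<Rightarrow> 'v" where
  "root C = (SOME r. r \<in> vertices C)"

text \<open>
  The sign of some walk from \<open>v\<close> to the root of its component, hence the exponent picked up when the
  value at \<open>v\<close> is moved to the root.  In a balanced component the choice of the walk is immaterial and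
  the weights form a potential; in any other component every choice will do.
\<close>

definition weight :: "'v \<Rightarrow> int" where
  "weight v = walk_sign G
     (SOME ds. walk (component_of G v) v ds (root (component_of G v)))"

lemma root_in: "C \<in> components G \<Longrightarrow> root C \<in> vertices C"
  using component_connected unfolding root_def connected_graph_def by (metis ex_in_conv someI_ex)

lemma weight_walk:
  assumes C: "C \<in> components G" "v \<in> vertices C"
  shows "\<exists>ds. walk C v ds (root C) \<and> walk_sign C ds = weight v"
proof -
  have "(v, root C) \<in> (adjacency C)\<^sup>*"
    using component_connected[OF C(1)] root_in[OF C(1)] C(2) by (simp add: connected_graph_def)
  then have "walk C v (SOME ds. walk C v ds (root C)) (root C)"
    using reachable_walk by (metis someI_ex)
  moreover have "weight v = walk_sign C (SOME ds. walk C v ds (root C))"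
    using component_eqI[OF C] walk_sign_mono[OF component_subgraph[OF C(1)]]
    by (simp add: weight_def)
  ultimately show ?thesis by metis
qed

lemma component_vertex: "C \<in> components G \<Longrightarrow> v \<in> vertices C \<Longrightarrow> v \<in> vertices G"
  by (auto dest!: component_subgraph simp: subgraph_def)

lemma component_signed_graph: "C \<in> components G \<Longrightarrow> signed_graph C"
  by (auto dest!: component_subgraph simp: subgraph_def)

lemma component_att:
  assumes "C \<in> components G"
  shows "att C = att G" "esign C = esign G" "edges C \<subseteq> edges G" "finite (vertices C)"
  using component_subgraph[OF assms] signed_graph.finite_vertices[OF component_signed_graph[OF assms]]
  by (auto simp: subgraph_def)

lemma weight_cases:
  assumes "C \<in> components G" "v \<in> vertices C" shows "weight v = 1 \<or> weight v = -1"
  using weight_walk[OF assms] signed_graph.walk_sign_cases[OF component_signed_graph[OF assms(1)]]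
  by metis

text \<open>
  What a chain amounts to on a component after all its values have been moved to the root.
\<close>

definition csum :: "('v, 'e) sgraph \<Rightarrow> ('v \<Rightarrow> 'a) \<Rightarrow> 'a" where
  "csum C x = finprod A (\<lambda>v. x v [^] weight v) (vertices C)"

lemma csum_hom:
  assumes C: "C \<in> components G" shows "csum C \<in> hom C0 A"
proof (rule homI)
  have cl: "x v \<in> carrier A" if "x \<in> carrier C0" "v \<in> vertices C" for x v
    using chain0_closed[OF that(1)] component_vertex[OF C that(2)] .
  show "csum C x \<in> carrier A" if "x \<in> carrier C0" for x
    unfolding csum_def by (rule A.finprod_closed) (simp add: cl[OF that])
  show "csum C (x \<otimes>\<^bsub>C0\<^esub> y) = csum C x \<otimes> csum C y" if "x \<in> carrier C0" "y \<in> carrier C0" for x y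
  proof -
    have "csum C (x \<otimes>\<^bsub>C0\<^esub> y) = finprod A (\<lambda>v. x v [^] weight v \<otimes> y v [^] weight v) (vertices C)"
      unfolding csum_def
      using cl[OF that(1)] cl[OF that(2)] component_vertex[OF C]
      by (intro A.finprod_cong') (simp_all add: chain0_mult A.int_pow_distrib)
    then show ?thesis
      using cl[OF that(1)] cl[OF that(2)] by (simp add: csum_def A.finprod_multf)
  qed
qed

lemma csum_closed: "C \<in> components G \<Longrightarrow> x \<in> carrier C0 \<Longrightarrow> csum C x \<in> carrier A"
  using csum_hom hom_in_carrier by metis

lemma csum_half:
  assumes C: "C \<in> components G" and a: "a \<in> carrier A"
  shows "csum C (half e i a) =
    (case att G e i of None \<Rightarrow> \<one> | Some u \<Rightarrow> if u \<in> vertices C then a [^] weight u else \<one>)"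
proof (cases "att G e i")
  case None
  then show ?thesis
    using hom_one[OF csum_hom[OF C]] by (simp add: half_def C0.is_group A.is_group)
next
  case (Some u)
  have eq: "single u a v [^] weight v = (if u = v then a [^] weight v else \<one>)"
    if "v \<in> vertices C" for v
    using component_vertex[OF C that] by (simp add: single_def)
  have "csum C (single u a) = finprod A (\<lambda>v. if u = v then a [^] weight v else \<one>) (vertices C)"
    unfolding csum_def using a by (intro A.finprod_cong') (simp_all add: eq)
  also have "\<dots> = (if u \<in> vertices C then a [^] weight u else \<one>)"
  proof (cases "u \<in> vertices C")
    case True
    then show ?thesis
      using a component_att(4)[OF C] by (simp add: A.finprod_singleton)
  next
    case False
    then have "finprod A (\<lambda>v. if u = v then a [^] weight v else \<one>) (vertices C) = \<one>"
      by (intro A.finprod_one_eqI) auto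
    with False show ?thesis by simp
  qed
  finally show ?thesis using Some by (simp add: half_def)
qed

text \<open>
  The values at the root of a component that die in homology.
\<close>

definition value_subgroup :: "('v, 'e) sgraph \<Rightarrow> 'a set" where
  "value_subgroup C =
     (if balanced C then {\<one>} else if no_outer_edges C then doubles A else carrier A)"

lemma value_subgroup: "subgroup (value_subgroup C) A"
  by (simp add: value_subgroup_def A.triv_subgroup A.doubles_subgroup A.subgroup_self)

text \<open>
  In a component without outer-edges both ends of an edge contribute a weight times an arrow, that is,
  \<open>\<plusminus>1\<close>, so the total exponent of \<open>a\<close> is even.  If the weights form a potential, the two contributions
  cancel.
\<close>

lemma csum_edge_boundary:
  assumes C: "C \<in> components G" and d: "d \<in> arcs G" and a: "a \<in> carrier A"
  shows "csum C (edge_boundary d a) \<in> value_subgroup C"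
proof -
  obtain e t where et: "d = (e, t)" by (cases d)
  have e: "e \<in> edges G" and tT: "t True = 1 \<or> t True = -1" and tF: "t False = 1 \<or> t False = -1"
    and tt: "t True * t False = - esign G e"
    using d by (simp_all add: et arcs_def)
  have eq: "csum C (edge_boundary d a) =
      csum C (half e True (a [^] t True)) \<otimes> csum C (half e False (a [^] t False))"
    using a hom_mult[OF csum_hom[OF C]] by (simp add: et edge_boundary_def half_closed)
  show ?thesis
  proof (cases "\<exists>i u. att G e i = Some u \<and> u \<in> vertices C")
    case False
    then have "csum C (half e i b) = \<one>" if "b \<in> carrier A" for i b
      unfolding csum_half[OF C that] by (simp split: option.split)
    then have "csum C (edge_boundary d a) = \<one>"
      using a by (simp add: eq)
    then show ?thesis using subgroup.one_closed[OF value_subgroup] by simp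
  next
    case True
    \<comment> \<open>An edge with one end in the component belongs to it, so its other end is there or is free.\<close>
    then have eC: "e \<in> edges C" using edge_in_component[OF C e] by blast
    interpret C: signed_graph C by (rule component_signed_graph[OF C])
    show ?thesis
    proof (cases "no_outer_edges C")
      case False
      then have "value_subgroup C = carrier A"
        by (simp add: value_subgroup_def balanced_def)
      then show ?thesis using csum_closed[OF C edge_boundary_closed[OF a]] by simp
    next
      case True
      obtain u where u: "att C e True = Some u" by (rule C.no_outer_edges_both_ends[OF True eC])
      obtain v where v: "att C e False = Some v" by (rule C.no_outer_edges_both_ends[OF True eC])
      note uC = C.att_closed[OF eC u] and vC = C.att_closed[OF eC v]
      define n where "n = t True * weight u + t False * weight v"
      have "csum C (edge_boundary d a) = a [^] n"
        using a u v uC vC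
        by (simp add: eq csum_half[OF C] component_att[OF C] A.int_pow_pow A.int_pow_mult n_def)
      show ?thesis
      proof (cases "balanced C")
        case True
        have "C.potential weight"
          by (rule C.balanced_walk_signs_potential[OF True weight_walk[OF C]])
        moreover have "att C e (\<not> True) = Some v" using v by simp
        ultimately have "weight u * weight v = esign G e"
          using eC u unfolding C.potential_def component_att(2)[OF C] by blast
        then have "n = 0"
          using tt tT tF weight_cases[OF C uC] weight_cases[OF C vC]
          unfolding n_def by (elim disjE) simp_all
        then show ?thesis
          using \<open>csum C (edge_boundary d a) = a [^] n\<close> True by (simp add: value_subgroup_def)
      next
        case False
        have "even n"
          using tT tF weight_cases[OF C uC] weight_cases[OF C vC]
          unfolding n_def by (elim disjE) simp_all
        then obtain k where "n = k * 2" by (metis dvd_def mult.commute)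
        then have "a [^] n = (a [^] k) [^] (2::int)"
          using A.int_pow_pow[OF a] by simp
        also have "\<dots> = (a [^] k) [^] (2::nat)"
          using int_pow_int[of A "a [^] k" 2] by simp
        finally have "a [^] n = (a [^] k) [^] (2::nat)" .
        then have "a [^] n \<in> doubles A"
          using a by (auto simp: doubles_def)
        then show ?thesis
          using \<open>csum C (edge_boundary d a) = a [^] n\<close> False True by (simp add: value_subgroup_def)
      qed
    qed
  qed
qed

lemma csum_boundary:
  assumes C: "C \<in> components G" and x: "x \<in> B0"
  shows "csum C x \<in> value_subgroup C"
proof -
  obtain c where c: "c \<in> carrier C1" "x = boundary G A c" using x by blast
  let ?f = "\<lambda>e. edge_boundary (orient G e) (c (orient G e))"
  have cl: "c (orient G e) \<in> carrier A" if "e \<in> edges G" for e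
    using chain1_closed[OF c(1) orient_arc(1)[OF that]] .
  then have "?f \<in> edges G \<rightarrow> carrier C0"
    using edge_boundary_closed by blast
  then have "csum C x = finprod A (\<lambda>e. csum C (?f e)) (edges G)"
    unfolding c(2) boundary_eq_finprod[OF c(1)]
    by (rule C0.hom_finprod[OF A.comm_group_axioms csum_hom[OF C]])
  moreover have "(\<lambda>e. csum C (?f e)) \<in> edges G \<rightarrow> value_subgroup C"
    using csum_edge_boundary[OF C orient_arc(1) cl] by blast
  ultimately show ?thesis
    using A.finprod_in_subgroup[OF value_subgroup] by simp
qed

text \<open>
  In an unbalanced component without outer-edges a negative closed walk at the root identifies the
  class of \<open>b\<close> with its inverse, which kills squares.  If there is an outer-edge, every value can be moved
  to its vertex, where it is a boundary.
\<close>

lemma vclass_root_value_subgroup: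
  assumes C: "C \<in> components G" and a: "a \<in> value_subgroup C"
  shows "vclass (root C) a = \<one>\<^bsub>H0\<^esub>"
proof -
  interpret r: group_hom A H0 "vclass (root C)" by (rule vclass_group_hom)
  interpret C: signed_graph C by (rule component_signed_graph[OF C])
  consider "balanced C" | "\<not> balanced C" "no_outer_edges C" | "\<not> no_outer_edges C" by blast
  then show ?thesis
  proof cases
    case 1
    then show ?thesis using a by (simp add: value_subgroup_def)
  next
    case 2
    then obtain b where b: "b \<in> carrier A" "a = b [^] (2::nat)"
      using a by (auto simp: value_subgroup_def doubles_def)
    obtain ds where "walk C (root C) ds (root C)" "walk_sign C ds = -1"
      using C.unbalanced_negative_closed_walk[OF component_connected[OF C] 2(2,1) root_in[OF C]]
      by blast
    then have "walk G (root C) ds (root C)" "walk_sign G ds = -1"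
      using walk_mono walk_sign_mono component_subgraph[OF C] by metis+
    then have "vclass (root C) b = vclass (root C) (inv b)"
      using vclass_walk[of "root C" ds "root C" b] b(1) by (simp add: A.int_pow_neg)
    then have "vclass (root C) b \<otimes>\<^bsub>H0\<^esub> vclass (root C) b = \<one>\<^bsub>H0\<^esub>"
      using b(1) r.hom_closed[OF b(1)] by (metis H0.l_inv r.hom_inv)
    then show ?thesis
      using b by (simp add: numeral_2_eq_2)
  next
    case 3
    then obtain e where e: "e \<in> edges C" "outer_edge C e" by (auto simp: no_outer_edges_def)
    then obtain i where i: "att C e i \<noteq> None" "\<And>j. att C e j \<noteq> None \<Longrightarrow> j = i"
      unfolding outer_edge_def by blast
    then obtain u where u: "att C e i = Some u" by blast
    have "att C e (\<not> i) = None" using i(2)[of "\<not> i"] by (cases "att C e (\<not> i)") auto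
    then have outer: "vclass u b = \<one>\<^bsub>H0\<^esub>" if "b \<in> carrier A" for b
      using vclass_outer[of e i u b] e(1) u component_att[OF C] that by auto
    obtain ds where "walk C u ds (root C)"
      using weight_walk[OF C C.att_closed[OF e(1) u]] by blast
    then have w: "walk G (root C) (reverse_walk ds) u"
      using walk_mono[OF component_subgraph[OF C]] walk_reverse by metis
    have "a \<in> carrier A" using a subgroup.subset[OF value_subgroup] by blast
    then show ?thesis
      using vclass_walk[OF w] outer by simp
  qed
qed

text \<open>
  A chain is the product of its one-vertex parts; each part is moved to the root of its component, and
  the parts are then collected component by component.
\<close>

lemma cls_eq_finprod:
  assumes x: "x \<in> carrier C0"
  shows "cls x = finprod H0 (\<lambda>C. vclass (root C) (csum C x)) (components G)"
proof -
  have xv: "x v \<in> carrier A" if "v \<in> vertices G" for v using chain0_closed[OF x that] .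
  have vc: "vclass v a \<in> carrier H0" if "a \<in> carrier A" for v a
    using vclass_hom that by (rule hom_in_carrier)
  let ?g = "\<lambda>v. vclass (root (component_of G v)) (x v [^] weight v)"
  have single: "(\<lambda>v. single v (x v)) \<in> vertices G \<rightarrow> carrier C0"
    using single_closed xv by blast
  have "cls x = cls (finprod C0 (\<lambda>v. single v (x v)) (vertices G))"
    using chain0_eq_finprod_single[OF x] by simp
  also have "\<dots> = finprod H0 (\<lambda>v. vclass v (x v)) (vertices G)"
    unfolding vclass_def by (rule C0.hom_finprod[OF H0.comm_group_axioms cls_hom single])
  also have "\<dots> = finprod H0 ?g (vertices G)"
  proof (rule H0.finprod_cong'[OF refl])
    show "?g \<in> vertices G \<rightarrow> carrier H0" using vc xv by blast
    fix v assume v: "v \<in> vertices G"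
    then have C: "component_of G v \<in> components G" by (simp add: components_eq)
    have "v \<in> vertices (component_of G v)" by (simp add: component_of_def)
    then obtain ds where "walk (component_of G v) v ds (root (component_of G v))"
      "walk_sign (component_of G v) ds = weight v"
      using weight_walk[OF C] by blast
    then have "walk G v ds (root (component_of G v))" "walk_sign G ds = weight v"
      using walk_mono walk_sign_mono component_subgraph[OF C] by metis+
    then show "vclass v (x v) = ?g v"
      using vclass_walk[OF _ xv[OF v]] by metis
  qed
  also have "\<dots> = finprod H0 ?g (\<Union>(vertices ` components G))"
    by (simp add: vertices_components)
  also have "\<dots> = finprod H0 (\<lambda>C. finprod H0 ?g (vertices C)) (components G)"
  proof (rule H0.finprod_UN_disjoint[OF finite_components])
    show "finite (vertices C)" if "C \<in> components G" for C
      using component_att(4)[OF that] .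
    show "pairwise (\<lambda>C D. disjnt (vertices C) (vertices D)) (components G)"
      using components_disjoint by (auto simp: pairwise_def disjnt_def)
    show "?g v \<in> carrier H0" if "C \<in> components G" "v \<in> vertices C" for C v
      using vc xv component_vertex[OF that] by simp
  qed
  also have "\<dots> = finprod H0 (\<lambda>C. vclass (root C) (csum C x)) (components G)"
  proof (rule H0.finprod_cong'[OF refl])
    show "(\<lambda>C. vclass (root C) (csum C x)) \<in> components G \<rightarrow> carrier H0"
      using vc csum_closed[OF _ x] by blast
    fix C assume C: "C \<in> components G"
    have cl: "(\<lambda>v. x v [^] weight v) \<in> vertices C \<rightarrow> carrier A"
      using xv component_vertex[OF C] by simp
    have "vclass (root C) (csum C x) = finprod H0 (\<lambda>v. vclass (root C) (x v [^] weight v)) (vertices C)"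
      unfolding csum_def by (rule A.hom_finprod[OF H0.comm_group_axioms vclass_hom cl])
    also have "\<dots> = finprod H0 ?g (vertices C)"
    proof (rule H0.finprod_cong'[OF refl])
      show "?g \<in> vertices C \<rightarrow> carrier H0" using vc xv component_vertex[OF C] by simp
      show "vclass (root C) (x v [^] weight v) = ?g v" if "v \<in> vertices C" for v
        using component_eqI[OF C that] by simp
    qed
    finally show "finprod H0 ?g (vertices C) = vclass (root C) (csum C x)" ..
  qed
  finally show ?thesis .
qed

text \<open>
  Moving values to the roots changes a chain by a boundary only, so the chain is a boundary as soon as
  all its root values die.  The converse is \<open>csum_boundary\<close>.
\<close>

lemma boundary_iff_csum:
  assumes x: "x \<in> carrier C0"
  shows "x \<in> B0 \<longleftrightarrow> (\<forall>C\<in>components G. csum C x \<in> value_subgroup C)"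
proof
  show "\<forall>C\<in>components G. csum C x \<in> value_subgroup C" if "x \<in> B0"
    using csum_boundary that by blast
  assume *: "\<forall>C\<in>components G. csum C x \<in> value_subgroup C"
  have "cls x = \<one>\<^bsub>H0\<^esub>"
    unfolding cls_eq_finprod[OF x]
    using * vclass_root_value_subgroup by (intro H0.finprod_one_eqI) simp
  then show "x \<in> B0" using cls_eq_one_iff[OF x] by simp
qed

text \<open>
  Put the prescribed values at the roots.  The walk chosen from a root to itself may be negative, so the
  value is twisted by the weight of the root.
\<close>

lemma csum_surjective:
  assumes p: "\<And>C. C \<in> components G \<Longrightarrow> p C \<in> carrier A"
  shows "\<exists>x\<in>carrier C0. \<forall>C\<in>components G. csum C x = p C"
proof (intro bexI ballI)
  define x where "x = (\<lambda>v\<in>vertices G.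
    if root (component_of G v) = v then p (component_of G v) [^] weight v else \<one>)"
  show "x \<in> carrier C0"
    using p by (simp add: chain0_def x_def components_eq)
  fix C assume C: "C \<in> components G"
  have xv: "x v [^] weight v = (if root C = v then p C else \<one>)" if v: "v \<in> vertices C" for v
  proof -
    have "weight v * weight v = 1" using weight_cases[OF C v] by auto
    then show ?thesis
      using p[OF C] component_vertex[OF C v]
      by (simp add: x_def component_eqI[OF C v, symmetric] A.int_pow_pow)
  qed
  have "csum C x = finprod A (\<lambda>v. if root C = v then p C else \<one>) (vertices C)"
    unfolding csum_def using p[OF C] xv by (intro A.finprod_cong') simp_all
  also have "\<dots> = p C"
    using root_in[OF C] component_att(4)[OF C] p[OF C] by (intro A.finprod_singleton) simp_all
  finally show "csum C x = p C" .
qed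

text \<open>
  The isomorphism is induced by the component values, taken modulo \<open>doubles A\<close> on unbalanced components
  without outer-edges, exactly on balanced ones, and discarded on components with outer-edges.
\<close>

theorem homology0_iso:
  "H0 \<cong> direct_power (A Mod doubles A) (num_unbalanced_closed G) \<times>\<times> direct_power A (num_balanced G)"
proof -
  define U where "U = {C \<in> components G. \<not> balanced C \<and> no_outer_edges C}"
  define W where "W = {C \<in> components G. balanced C}"
  define nu where "nu = num_unbalanced_closed G"
  define nb where "nb = num_balanced G"
  have sub: "U \<subseteq> components G" "W \<subseteq> components G" by (auto simp: U_def W_def)
  obtain cu where cu: "bij_betw cu {..<nu} U"
    using ex_bij_betw_nat_finite[OF finite_subset[OF sub(1) finite_components]]
    by (auto simp: nu_def num_unbalanced_closed_def U_def atLeast0LessThan)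
  obtain cb where cb: "bij_betw cb {..<nb} W"
    using ex_bij_betw_nat_finite[OF finite_subset[OF sub(2) finite_components]]
    by (auto simp: nb_def num_balanced_def W_def atLeast0LessThan)
  have cuU: "cu i \<in> U" if "i \<in> {..<nu}" for i using bij_betwE[OF cu] that by blast
  have cbW: "cb i \<in> W" if "i \<in> {..<nb}" for i using bij_betwE[OF cb] that by blast
  have cuC: "cu i \<in> components G" if "i \<in> {..<nu}" for i using cuU[OF that] sub by blast
  have cbC: "cb i \<in> components G" if "i \<in> {..<nb}" for i using cbW[OF that] sub by blast
  let ?Q = "A Mod doubles A"
  let ?T = "direct_power ?Q nu \<times>\<times> direct_power A nb"
  define f where "f x = (\<lambda>i\<in>{..<nu}. doubles A #> csum (cu i) x)" for x
  define g where "g x = (\<lambda>i\<in>{..<nb}. csum (cb i) x)" for x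
  have "(\<lambda>x. doubles A #> csum (cu i) x) \<in> hom C0 ?Q" if "i \<in> {..<nu}" for i
    using hom_compose[OF csum_hom[OF cuC[OF that]] normal.r_coset_hom_Mod[OF A.doubles_normal]]
    by (simp add: comp_def)
  then have f: "f \<in> hom C0 (direct_power ?Q nu)"
    unfolding f_def[abs_def] by (rule hom_into_product_group)
  have g: "g \<in> hom C0 (direct_power A nb)"
    unfolding g_def[abs_def] by (rule hom_into_product_group) (rule csum_hom[OF cbC])
  have grpQ: "group ?Q" using A.Mod_doubles_comm_group by (rule comm_group.axioms)
  have "group ?T"
    using grpQ A.is_group by (intro DirProd_group product_group)
  then interpret h: group_hom C0 ?T "\<lambda>x. (f x, g x)"
    using f g by (simp add: group_hom_def group_hom_axioms_def hom_paired C0.is_group)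
  have ker: "kernel C0 ?T (\<lambda>x. (f x, g x)) = B0"
  proof -
    have "(f x, g x) = \<one>\<^bsub>?T\<^esub> \<longleftrightarrow> x \<in> B0" if x: "x \<in> carrier C0" for x
    proof -
      have coset: "doubles A #> a = doubles A \<longleftrightarrow> a \<in> doubles A" if "a \<in> carrier A" for a
        using A.coset_join1[OF _ that A.doubles_subgroup] A.coset_join2[OF that A.doubles_subgroup]
        by blast
      have "f x = \<one>\<^bsub>direct_power ?Q nu\<^esub> \<longleftrightarrow> (\<forall>i\<in>{..<nu}. doubles A #> csum (cu i) x = doubles A)"
        unfolding f_def one_product_group by (auto simp: FactGroup_def restrict_def fun_eq_iff)
      also have "\<dots> \<longleftrightarrow> (\<forall>i\<in>{..<nu}. csum (cu i) x \<in> doubles A)"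
        using coset[OF csum_closed[OF cuC x]] by blast
      also have "\<dots> \<longleftrightarrow> (\<forall>C\<in>U. csum C x \<in> doubles A)"
        unfolding bij_betw_imp_surj_on[OF cu, symmetric] by blast
      finally have 1: "f x = \<one>\<^bsub>direct_power ?Q nu\<^esub> \<longleftrightarrow> (\<forall>C\<in>U. csum C x \<in> doubles A)" .
      have "g x = \<one>\<^bsub>direct_power A nb\<^esub> \<longleftrightarrow> (\<forall>i\<in>{..<nb}. csum (cb i) x = \<one>)"
        unfolding g_def one_product_group by (auto simp: restrict_def fun_eq_iff)
      also have "\<dots> \<longleftrightarrow> (\<forall>C\<in>W. csum C x = \<one>)"
        unfolding bij_betw_imp_surj_on[OF cb, symmetric] by blast
      finally have 2: "g x = \<one>\<^bsub>direct_power A nb\<^esub> \<longleftrightarrow> (\<forall>C\<in>W. csum C x = \<one>)" .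
      have "(\<forall>C\<in>components G. csum C x \<in> value_subgroup C) \<longleftrightarrow>
          (\<forall>C\<in>U. csum C x \<in> doubles A) \<and> (\<forall>C\<in>W. csum C x = \<one>)"
        using csum_closed[OF _ x] by (auto simp: U_def W_def value_subgroup_def)
      then show ?thesis
        using 1 2 boundary_iff_csum[OF x] by (simp only: one_DirProd prod.inject)
    qed
    then have "kernel C0 ?T (\<lambda>x. (f x, g x)) = {x \<in> carrier C0. x \<in> B0}"
      unfolding kernel_def by blast
    then show ?thesis using subgroup.subset[OF boundaries_subgroup] by blast
  qed
  have "(\<lambda>x. (f x, g x)) ` carrier C0 = carrier ?T"
  proof (intro equalityI subsetI)
    fix y assume "y \<in> carrier ?T"
    then obtain s t where y: "y = (s, t)" and s: "s \<in> (\<Pi>\<^sub>E i\<in>{..<nu}. carrier ?Q)"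
      and t: "t \<in> (\<Pi>\<^sub>E i\<in>{..<nb}. carrier A)"
      by auto
    have "\<exists>a\<in>carrier A. s i = doubles A #> a" if "i \<in> {..<nu}" for i
      using PiE_mem[OF s that] by (auto simp: FactGroup_def RCOSETS_def)
    then obtain r where r: "\<And>i. i \<in> {..<nu} \<Longrightarrow> r i \<in> carrier A"
      "\<And>i. i \<in> {..<nu} \<Longrightarrow> s i = doubles A #> r i"
      by metis
    \<comment> \<open>Components with outer-edges may be given any value; the neutral element is chosen.\<close>
    define p where "p C = (if C \<in> U then r (inv_into {..<nu} cu C)
      else if C \<in> W then t (inv_into {..<nb} cb C) else \<one>)" for C
    have "p C \<in> carrier A" for C
    proof -
      have "r (inv_into {..<nu} cu C) \<in> carrier A" if "C \<in> U"
        using r(1)[OF inv_into_into[of C cu]] that unfolding bij_betw_imp_surj_on[OF cu] .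
      moreover have "t (inv_into {..<nb} cb C) \<in> carrier A" if "C \<in> W"
        using PiE_mem[OF t inv_into_into[of C cb]] that unfolding bij_betw_imp_surj_on[OF cb] .
      ultimately show ?thesis by (simp add: p_def)
    qed
    then obtain x where x: "x \<in> carrier C0" "\<And>C. C \<in> components G \<Longrightarrow> csum C x = p C"
      using csum_surjective[of p] by blast
    have "f x i = s i" if i: "i \<in> {..<nu}" for i
      using x(2)[OF cuC[OF i]] cuU[OF i] r(2)[OF i] bij_betw_inv_into_left[OF cu i] i
      by (simp add: f_def p_def)
    moreover have "f x \<in> (\<Pi>\<^sub>E i\<in>{..<nu}. carrier ?Q)"
      using hom_in_carrier[OF f x(1)] by simp
    ultimately have "f x = s" using s by (intro PiE_ext) auto
    have "g x i = t i" if i: "i \<in> {..<nb}" for i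
    proof -
      have "cb i \<notin> U" using cbW[OF i] by (auto simp: U_def W_def)
      then show ?thesis
        using x(2)[OF cbC[OF i]] cbW[OF i] bij_betw_inv_into_left[OF cb i] i
        by (simp add: g_def p_def)
    qed
    moreover have "g x \<in> (\<Pi>\<^sub>E i\<in>{..<nb}. carrier A)"
      using hom_in_carrier[OF g x(1)] by simp
    ultimately have "g x = t" using t by (intro PiE_ext) auto
    with \<open>f x = s\<close> x(1) y show "y \<in> (\<lambda>x. (f x, g x)) ` carrier C0" by blast
  next
    fix y assume "y \<in> (\<lambda>x. (f x, g x)) ` carrier C0"
    then show "y \<in> carrier ?T" using h.hom_closed by blast
  qed
  from h.FactGroup_iso[OF this] show ?thesis
    unfolding ker unfolding homology0_def nu_def nb_def .
qed

end

section \<open>The homology group\<close>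

theorem theorem5p3:
  fixes \<Sigma> :: "('v, 'e) sgraph" and A :: "('a, 'm) monoid_scheme"
  assumes "signed_graph \<Sigma>" and "comm_group A"
  shows "homology0 \<Sigma> A \<cong>
           direct_power (A Mod doubles A) (num_unbalanced_closed \<Sigma>) \<times>\<times>
           direct_power A (num_balanced \<Sigma>) \<and>
         (finite (carrier A) \<longrightarrow>
           homology0 \<Sigma> A \<cong>
             direct_power (tor2 A) (num_unbalanced_closed \<Sigma>) \<times>\<times>
             direct_power A (num_balanced \<Sigma>))"
proof (intro conjI impI)
  interpret signed_graph_coefficients \<Sigma> A
    using assms by (simp add: signed_graph_coefficients_def)
  let ?u = "num_unbalanced_closed \<Sigma>" and ?b = "num_balanced \<Sigma>"
  show iso: "homology0 \<Sigma> A \<cong> direct_power (A Mod doubles A) ?u \<times>\<times> direct_power A ?b"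
    by (rule homology0_iso)
  assume fin: "finite (carrier A)"
  have "direct_power (A Mod doubles A) ?u \<cong> direct_power (tor2 A) ?u"
    using A.Mod_doubles_iso_tor2[OF fin] A.Mod_doubles_comm_group A.tor2_comm_group
    by (intro iso_product_groupI) (simp_all add: comm_group.axioms)
  then have "direct_power (A Mod doubles A) ?u \<times>\<times> direct_power A ?b \<cong>
      direct_power (tor2 A) ?u \<times>\<times> direct_power A ?b"
    using A.Mod_doubles_comm_group
    by (intro group.DirProd_iso_trans iso_refl) (simp_all add: comm_group.axioms)
  with iso show "homology0 \<Sigma> A \<cong> direct_power (tor2 A) ?u \<times>\<times> direct_power A ?b"
    by (rule iso_trans)
qed

end
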